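(* Let $d\ge 1$ be an integer, let $X_1,X_2,\ldots$ be independent random points uniformly distributed in $Q_d=[0,1]^d$, and let $N_n$ be the number of chain records among $X_1,\ldots,X_n$. Then, as $n\to\infty$, $$\mathbb{E}[N_n]\sim \frac{1}{d}\,\log n,\qquad \mathrm{Var}[N_n]\sim \frac{1}{d^{2}}\,\log n,$$ and $N_n$ is asymptotically Gaussian with these moments, i.e. $$\frac{N_n-d^{-1}\log n}{d^{-1}\sqrt{\log n}}$$ converges in distribution to the standard normal law.
   Context: For $x,y\in\mathbb{R}^d$ write $x\prec y$ iff $x\neq y$ and $x^{(i)}\le y^{(i)}$ for all $i=1,\ldots,d$. The chain records of the sequence $X_1,X_2,\ldots$ are defined recursively: $T_1=1$, $R_1=X_1$, and for $k>1$, $T_k=\min\{n>T_{k-1}: X_n\prec R_{k-1}\}$, $R_k=X_{T_k}$. (Almost surely all $T_k$ are finite.) The $T_k$ are the record indices and the $R_k$ the record values. The number of chain records among the first $n$ marks is $N_n=\#\{k\ge 1: T_k\le n\}$. *)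

theory Defs
  imports "HOL-Probability.Probability" "HOL-Library.Extended_Nat"
    "HOL-Library.Landau_Symbols"
begin

definition strictly_below :: "real ^ 'd \<Rightarrow> real ^ 'd \<Rightarrow> bool"  (infix "\<prec>" 50)
  where "x \<prec> y \<longleftrightarrow> x \<noteq> y \<and> (\<forall>i. x $ i \<le> y $ i)"

text \<open>
  The sequence of marks is \<open>x 1, x 2, \<dots>\<close> (the value \<open>x 0\<close> is never inspected), and record
  indices are numbered from 1 (the value at 0 is a dummy). Since \<open>Inf {} = \<infinity>\<close> in \<^typ>\<open>enat\<close>,
  the index is \<open>\<infinity>\<close> if there is no further record; it then stays \<open>\<infinity>\<close>, because no natural
  number exceeds \<open>\<infinity>\<close>.
\<close>

fun record_index :: "(nat \<Rightarrow> real ^ 'd) \<Rightarrow> nat \<Rightarrow> enat" where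
  "record_index x 0 = 0"
| "record_index x (Suc 0) = 1"
| "record_index x (Suc (Suc k)) =
     Inf {enat n | n. record_index x (Suc k) < enat n
                      \<and> x n \<prec> x (the_enat (record_index x (Suc k)))}"

definition num_records :: "(nat \<Rightarrow> real ^ 'd) \<Rightarrow> nat \<Rightarrow> nat"
  where "num_records x n = card {k. 1 \<le> k \<and> record_index x k \<le> enat n}"

end

theory Submission
  imports Defs "HOL-Real_Asymp.Real_Asymp"
begin

text \<open>
  Let \<open>K\<^sub>n\<close> be the number of records, \<open>V\<^sub>n\<close> the product of the coordinates of the current record and
  \<open>L\<^sub>n = - ln V\<^sub>n\<close>, starting from \<open>K\<^sub>0 = 0\<close>, \<open>V\<^sub>0 = 1\<close>. Given the past, a new record occurs with
  probability \<open>V\<^sub>n\<close>, and then \<open>(K, L)\<close> becomes \<open>(K + 1, L + g)\<close>, where \<open>g\<close> has the Gamma law with shape \<open>d\<close>.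

  Since \<open>E V\<^sub>n\<^sub>+\<^sub>1 \<le> E V\<^sub>n - (E V\<^sub>n)\<^sup>2 / 2\<close> and \<open>E V\<^sub>n\<^sub>+\<^sub>1\<^sup>-\<^sup>1\<^sup>/\<^sup>2 = E V\<^sub>n\<^sup>-\<^sup>1\<^sup>/\<^sup>2 + (2\<^sup>d - 1) E V\<^sub>n\<^sup>1\<^sup>/\<^sup>2\<close>, both \<open>E (n V\<^sub>n)\<close> and
  \<open>E (n V\<^sub>n)\<^sup>-\<^sup>1\<^sup>/\<^sup>2\<close> are bounded, so \<open>L\<^sub>n - ln n\<close> has bounded exponential moments. As \<open>K\<^sub>n - L\<^sub>n / d\<close> is a
  martingale with second moment \<open>E K\<^sub>n / d\<close>, the mean and the variance of \<open>K\<^sub>n\<close> follow.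

  For the limit law, \<open>(1 + s)\<^sup>d\<^sup>K V\<^sup>s\<close> is a martingale for complex \<open>s\<close>. Taking \<open>1 + s = e\<^sup>i\<^sup>t\<close>
  with \<open>t\<close> of order \<open>(ln n)\<^sup>-\<^sup>1\<^sup>/\<^sup>2\<close> turns its first factor into the integrand of the characteristic function
  of \<open>d K\<^sub>n\<close>, while the second one is close to \<open>n\<^sup>-\<^sup>s\<close>.
\<close>

subsection \<open>Record indices and the record count\<close>

text \<open>
  The first mark is a record unconditionally, as in \<open>record_index\<close>; the initial value 1 is the top
  corner of the cube, so almost surely the first step follows the same rule as all others.
\<close>

fun current_record :: "(nat \<Rightarrow> real ^ 'd) \<Rightarrow> nat \<Rightarrow> real ^ 'd" where
  "current_record x 0 = 1"
| "current_record x (Suc n) =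
     (if n = 0 \<or> x (Suc n) \<prec> current_record x n then x (Suc n) else current_record x n)"

fun record_count :: "(nat \<Rightarrow> real ^ 'd) \<Rightarrow> nat \<Rightarrow> nat" where
  "record_count x 0 = 0"
| "record_count x (Suc n) =
     record_count x n + (if n = 0 \<or> x (Suc n) \<prec> current_record x n then 1 else 0)"

text \<open>Every candidate in the infimum is a natural number above m, hence at least
  \<open>Suc m\<close>. This lower bound survives when there is no candidate and the infimum is
  \<infinity>.\<close>

lemma record_index_less:
  fixes x :: "nat \<Rightarrow> real ^ 'd"
  assumes "1 \<le> k" "record_index x k = enat m"
  shows "enat m < record_index x (Suc k)"
proof -
  obtain j where j: "k = Suc j"
    using assms(1) by (cases k) auto
  have "enat (Suc m) \<le> record_index x (Suc k)"
    using assms(2) unfolding j record_index.simps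
    by (intro Inf_greatest) auto
  then show ?thesis
    by (simp add: Suc_ile_eq)
qed

lemma record_index_mono_Suc:
  assumes "1 \<le> k"
  shows "record_index x k \<le> record_index x (Suc k)"
proof (cases "record_index x k")
  case (enat m)
  then show ?thesis
    using record_index_less[OF assms enat] by simp
next
  case infinity
  obtain j where "k = Suc j"
    using assms by (cases k) auto
  with infinity show ?thesis
    by (simp add: Inf_enat_def)
qed

lemma record_index_mono:
  assumes "1 \<le> k" "k \<le> l"
  shows "record_index x k \<le> record_index x l"
  using assms(2)
proof (induction l rule: dec_induct)
  case (step n)
  then show ?case
    using record_index_mono_Suc[of n x] assms(1) by (meson le_trans order.trans)
qed simp

lemma record_index_Suc_eq:
  fixes x :: "nat \<Rightarrow> real ^ 'd"
  assumes "1 \<le> k" "record_index x k = enat m"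
  shows "record_index x (Suc k) = Inf {enat n | n. m < n \<and> x n \<prec> x m}"
proof -
  obtain j where j: "k = Suc j"
    using assms(1) by (cases k) auto
  show ?thesis
    unfolding j record_index.simps assms(2)[unfolded j] by simp
qed

text \<open>Links the two recursions: the count k is the position with T_k \<le> n < T_(k+1), and
  the mark at T_k is the current record. The induction starts at n = 1 because position 0 is only a
  dummy in \<open>record_index\<close>.\<close>

lemma record_count_invariant:
  fixes x :: "nat \<Rightarrow> real ^ 'd"
  assumes "1 \<le> n"
  defines "k \<equiv> record_count x n"
  shows "1 \<le> k \<and> (\<exists>m\<le>n. record_index x k = enat m \<and> x m = current_record x n)
           \<and> enat n < record_index x (Suc k)"
  using assms(1) unfolding k_def
proof (induction n rule: dec_induct)
  case base
  have "record_index x (Suc 0) = enat 1"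
    by (simp add: one_enat_def)
  from record_index_less[OF _ this] this show ?case
    by auto
next
  case (step n)
  define k where "k = record_count x n"
  obtain m where m: "m \<le> n" "record_index x k = enat m" "x m = current_record x n"
    and k1: "1 \<le> k" and next_gt: "enat n < record_index x (Suc k)"
    using step.IH unfolding k_def by blast
  note idx = record_index_Suc_eq[OF k1 m(2)]
  have n0: "n \<noteq> 0"
    using step.hyps by simp
  show ?case
  proof (cases "x (Suc n) \<prec> current_record x n")
    case True
    have "record_index x (Suc k) \<le> enat (Suc n)"
      unfolding idx using m True by (intro Inf_lower) auto
    moreover have "enat (Suc n) \<le> record_index x (Suc k)"
      using next_gt by (simp add: Suc_ile_eq)
    ultimately have eq: "record_index x (Suc k) = enat (Suc n)"
      by (rule antisym)
    moreover have "record_count x (Suc n) = Suc k"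
      using True by (simp add: k_def)
    ultimately show ?thesis
      using record_index_less[of "Suc k", OF _ eq] True by auto
  next
    case False
    \<comment> \<open>The infimum exceeds n, so every candidate does, and n + 1 is excluded by the
      case assumption; hence all candidates are at least n + 2.\<close>
    have ge: "enat (Suc (Suc n)) \<le> record_index x (Suc k)"
      unfolding idx
    proof (intro Inf_greatest)
      fix e assume "e \<in> {enat n | n. m < n \<and> x n \<prec> x m}"
      then obtain j where j: "e = enat j" "m < j" "x j \<prec> x m"
        by auto
      then have "record_index x (Suc k) \<le> enat j"
        unfolding idx by (intro Inf_lower) auto
      with next_gt have "n < j"
        using order.strict_trans2 by fastforce
      moreover have "j \<noteq> Suc n"
        using j False m by auto
      ultimately show "enat (Suc (Suc n)) \<le> e"
        using j by simp
    qed
    moreover have "record_count x (Suc n) = k"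
      using False n0 by (simp add: k_def)
    moreover have "enat (Suc n) < record_index x (Suc k)"
      using ge by (simp add: Suc_ile_eq)
    moreover have "current_record x (Suc n) = x m"
      using False n0 m by simp
    ultimately show ?thesis
      using k1 m(1,2) by (metis le_Suc_eq)
  qed
qed

text \<open>Record indices are monotone from position 1 on, so those not exceeding n occupy an
  initial segment; the invariant shows that it ends at \<open>record_count x n\<close>.\<close>

lemma num_records_eq_record_count: "num_records x n = record_count x n"
proof (cases "n = 0")
  case True
  have "\<not> record_index x k \<le> enat 0" if "1 \<le> k" for k
    using record_index_mono[OF order.refl that, of x] by (auto simp: zero_enat_def[symmetric])
  then have "{k. 1 \<le> k \<and> record_index x k \<le> enat n} = {}"
    using True by auto
  then show ?thesis
    unfolding num_records_def using True by (simp only: card.empty record_count.simps)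
next
  case False
  define k where "k = record_count x n"
  obtain m where m: "m \<le> n" "record_index x k = enat m" and k1: "1 \<le> k"
    and gt: "enat n < record_index x (Suc k)"
    using record_count_invariant[of n x] False unfolding k_def by auto
  have "record_index x l \<le> enat n \<longleftrightarrow> l \<le> k" if "1 \<le> l" for l
  proof
    assume "l \<le> k"
    then show "record_index x l \<le> enat n"
      using record_index_mono[OF that, of k x] m order.trans by fastforce
  next
    assume *: "record_index x l \<le> enat n"
    show "l \<le> k"
    proof (rule ccontr)
      assume "\<not> l \<le> k"
      then have "record_index x (Suc k) \<le> record_index x l"
        using that by (intro record_index_mono) auto
      with * gt show False
        by auto
    qed
  qed
  then have "{k. 1 \<le> k \<and> record_index x k \<le> enat n} = {1..k}"
    by auto
  then show ?thesis
    by (simp add: num_records_def k_def)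
qed

subsection \<open>The uniform law on the cube\<close>

abbreviation (input) cube_law :: "(real ^ 'd) measure" where
  "cube_law \<equiv> uniform_measure lborel (cbox 0 1)"

text \<open>The negative logarithm of the volume of the box below x, written as a sum because its
  terms are independent exponentials under the uniform law.\<close>

definition neg_log_vol :: "real ^ 'd \<Rightarrow> real" where
  "neg_log_vol x = (\<Sum>i\<in>UNIV. - ln (x $ i))"

text \<open>\<open>erlang_density k\<close> has shape k + 1, hence the shift: this is the Gamma law
  of shape d and rate 1 for d \<ge> 1.\<close>

abbreviation (input) gamma_law :: "nat \<Rightarrow> real measure" where
  "gamma_law d \<equiv> density lborel (\<lambda>x. ennreal (erlang_density (d - 1) 1 x))"

lemma measurable_neg_log_vol [measurable]: "neg_log_vol \<in> borel_measurable borel"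
  unfolding neg_log_vol_def by measurable

lemma nn_integral_lborel_vec_prod:
  fixes f :: "'d::finite \<Rightarrow> real \<Rightarrow> ennreal"
  assumes [measurable]: "\<And>i. f i \<in> borel_measurable borel"
  shows "(\<integral>\<^sup>+x. (\<Prod>i\<in>UNIV. f i ((x :: real^'d) $ i)) \<partial>lborel) = (\<Prod>i\<in>UNIV. \<integral>\<^sup>+x. f i x \<partial>lborel)"
proof -
  have Basis: "(Basis :: (real^'d) set) = range (\<lambda>i. axis i 1)"
    by (auto simp: Basis_vec_def)
  have inj: "inj (\<lambda>i. axis i 1 :: real^'d)"
    by (auto simp: inj_on_def axis_eq_axis)
  have re: "(\<Prod>b\<in>Basis. g b) = (\<Prod>i\<in>UNIV. g (axis i 1))" for g :: "real^'d \<Rightarrow> ennreal"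
    unfolding Basis by (subst prod.reindex[OF inj]) simp
  show ?thesis
    using nn_integral_lborel_prod[of "\<lambda>b::real^'d. f (axis_index b)"]
    by (simp add: re inner_axis)
qed

lemma emeasure_lborel_unit_cube [simp]: "emeasure lborel (cbox 0 (1::real^'d)) = 1"
  by (simp add: emeasure_lborel_cbox_eq cart_eq_inner_axis[symmetric] inner_Basis_inf_left)
     (auto simp: Basis_vec_def inner_axis intro!: prod.neutral)

lemma prob_space_cube_law: "prob_space (cube_law :: (real^'d) measure)"
  by (rule prob_space_uniform_measure) auto

lemma emeasure_cube_law_coordinates:
  fixes A :: "'d::finite \<Rightarrow> real set"
  assumes [measurable]: "\<And>i. A i \<in> sets borel"
  shows "emeasure cube_law {x::real^'d. \<forall>i. x $ i \<in> A i} = (\<Prod>i\<in>UNIV. emeasure lborel ({0..1} \<inter> A i))"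
proof -
  have "emeasure cube_law {x::real^'d. \<forall>i. x $ i \<in> A i}
      = emeasure lborel (cbox 0 1 \<inter> {x::real^'d. \<forall>i. x $ i \<in> A i})"
    by (subst emeasure_uniform_measure) (auto simp: divide_ennreal_def)
  also have "\<dots> = (\<integral>\<^sup>+x. indicator (cbox 0 1 \<inter> {x::real^'d. \<forall>i. x $ i \<in> A i}) x \<partial>lborel)"
    by (intro nn_integral_indicator[symmetric]) auto
  also have "\<dots> = (\<integral>\<^sup>+x. (\<Prod>i\<in>UNIV. indicator ({0..1} \<inter> A i) ((x :: real^'d) $ i)) \<partial>lborel)"
  proof (intro nn_integral_cong)
    fix x :: "real^'d"
    show "indicator (cbox 0 1 \<inter> {x. \<forall>i. x $ i \<in> A i}) x
        = (\<Prod>i\<in>UNIV. indicator ({0..1} \<inter> A i) (x $ i) :: ennreal)"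
    proof (cases "\<forall>i. x $ i \<in> {0..1} \<inter> A i")
      case True
      then have "x \<in> cbox 0 1 \<inter> {x. \<forall>i. x $ i \<in> A i}"
        by (auto simp: mem_box_cart)
      with True show ?thesis
        by simp
    next
      case False
      then have "x \<notin> cbox 0 1 \<inter> {x. \<forall>i. x $ i \<in> A i}"
        by (auto simp: mem_box_cart)
      moreover from False obtain i where "x $ i \<notin> {0..1} \<inter> A i"
        by auto
      then have "(\<Prod>i\<in>UNIV. indicator ({0..1} \<inter> A i) (x $ i) :: ennreal) = 0"
        by (intro prod_zero bexI[of _ i]) (auto simp: indicator_def)
      ultimately show ?thesis
        by simp
    qed
  qed
  also have "\<dots> = (\<Prod>i\<in>UNIV. emeasure lborel ({0..1} \<inter> A i))"
    by (subst nn_integral_lborel_vec_prod) auto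
  finally show ?thesis .
qed

lemma emeasure_cube_law_coordinate:
  assumes [measurable]: "A \<in> sets borel"
  shows "emeasure cube_law {x::real^'d. x $ j \<in> A} = emeasure lborel ({0..1} \<inter> A)"
proof -
  have "emeasure cube_law {x::real^'d. x $ j \<in> A}
      = emeasure cube_law {x::real^'d. \<forall>i. x $ i \<in> (if i = j then A else UNIV)}"
    by (intro arg_cong[where f="emeasure cube_law"]) auto
  also have "\<dots> = (\<Prod>i\<in>UNIV. emeasure lborel ({0..1} \<inter> (if i = j then A else UNIV)))"
    by (intro emeasure_cube_law_coordinates) auto
  also have "\<dots> = (\<Prod>i\<in>UNIV. if i = j then emeasure lborel ({0..1} \<inter> A) else 1)"
    by (intro prod.cong) auto
  also have "\<dots> = emeasure lborel ({0..1} \<inter> A)"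
    by (subst prod.delta) auto
  finally show ?thesis .
qed

text \<open>Independence amounts to the joint law being the product of the marginals, and product
  measures are determined on boxes, where \<open>emeasure_cube_law_coordinates\<close> computes both
  sides.\<close>

lemma indep_vars_coordinates:
  "prob_space.indep_vars cube_law (\<lambda>_. borel) (\<lambda>i (x::real^'d). x $ i) UNIV"
proof -
  interpret prob_space "cube_law :: (real^'d) measure"
    by (rule prob_space_cube_law)
  let ?D = "\<lambda>i::'d. distr cube_law borel (\<lambda>x::real^'d. x $ i)"
  interpret P: product_prob_space ?D UNIV
    by (intro product_prob_spaceI prob_space_distr) auto
  have "distr cube_law (PiM UNIV (\<lambda>_. borel)) (\<lambda>x::real^'d. \<lambda>i\<in>UNIV. x $ i) = PiM UNIV ?D"
  proof (rule P.PiM_eqI)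
    fix A :: "'d \<Rightarrow> real set"
    assume "\<And>i. i \<in> UNIV \<Longrightarrow> A i \<in> sets (?D i)"
    then have A[measurable]: "\<And>i. A i \<in> sets borel"
      by simp
    have "emeasure (distr cube_law (PiM UNIV (\<lambda>_. borel)) (\<lambda>x::real^'d. \<lambda>i\<in>UNIV. x $ i)) (Pi\<^sub>E UNIV A)
        = emeasure cube_law {x::real^'d. \<forall>i. x $ i \<in> A i}"
      by (subst emeasure_distr)
         (auto simp del: emeasure_uniform_measure intro!: measurable_restrict sets_PiM_I_finite
           arg_cong[where f="emeasure cube_law"])
    also have "\<dots> = (\<Prod>i\<in>UNIV. emeasure lborel ({0..1} \<inter> A i))"
      by (rule emeasure_cube_law_coordinates) auto
    also have "\<dots> = (\<Prod>i\<in>UNIV. emeasure (?D i) (A i))"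
      by (intro prod.cong refl, subst emeasure_distr)
         (auto simp: emeasure_cube_law_coordinate[symmetric] vimage_def simp del: emeasure_uniform_measure)
    finally show "emeasure (distr cube_law (PiM UNIV (\<lambda>_. borel)) (\<lambda>x::real^'d. \<lambda>i\<in>UNIV. x $ i)) (Pi\<^sub>E UNIV A)
        = (\<Prod>i\<in>UNIV. emeasure (?D i) (A i))" .
  qed (auto intro!: sets_PiM_cong)
  then show ?thesis
    by (subst indep_vars_iff_distr_eq_PiM) auto
qed

text \<open>Inversion: for U uniform on the unit interval, -ln U \<le> a exactly when U \<ge> exp
  (-a), an event of probability 1 - exp (-a).\<close>

lemma coordinate_exponential:
  "distributed cube_law lborel (\<lambda>x::real^'d. - ln (x $ i)) (exponential_density 1)"
proof (rule exponential_distributedI)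
  fix a :: real assume a: "0 \<le> a"
  have "emeasure cube_law {x \<in> space cube_law. - ln (x $ i) \<le> a}
      = emeasure cube_law {x::real^'d. x $ i \<in> {t. - ln t \<le> a}}"
    by simp
  also have "\<dots> = emeasure lborel ({0..1} \<inter> {t. - ln t \<le> a})"
    by (intro emeasure_cube_law_coordinate) measurable
  \<comment> \<open>The two sets can differ only at t = 0, where the value of \<open>ln\<close> is a
    convention, and this point is null.\<close>
  also have "\<dots> = emeasure lborel {exp (-a)..1}"
  proof (rule emeasure_eq_AE)
    show "AE x in lborel. (x \<in> {0..1} \<inter> {t. - ln t \<le> a}) = (x \<in> {exp (-a)..1})"
      using AE_lborel_singleton[of "0::real"]
    proof eventually_elim
      case (elim t)
      have "- ln t \<le> a \<longleftrightarrow> exp (-a) \<le> t" if "0 < t"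
        using that by (metis exp_ge_zero exp_gt_zero ln_exp ln_le_cancel_iff minus_le_iff)
      moreover have "exp (-a) \<le> t \<Longrightarrow> 0 < t"
        using exp_gt_zero[of "-a"] by linarith
      ultimately show ?case
        using elim by (auto simp: order_less_le)
    qed
  qed auto
  also have "\<dots> = 1 - ennreal (exp (- a * 1))"
    using a by (simp add: ennreal_minus[symmetric])
  finally show "emeasure cube_law {x \<in> space cube_law. - ln ((x::real^'d) $ i) \<le> a} = 1 - ennreal (exp (- a * 1))" .
qed auto

lemma neg_log_vol_distributed:
  "distributed cube_law lborel (neg_log_vol :: real^'d \<Rightarrow> real) (erlang_density (CARD('d) - 1) 1)"
proof -
  interpret prob_space "cube_law :: (real^'d) measure"
    by (rule prob_space_cube_law)
  have "indep_vars (\<lambda>_. borel) (\<lambda>i (x::real^'d). - ln (x $ i)) UNIV"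
    using indep_vars_compose2[OF indep_vars_coordinates, of "\<lambda>_ t. - ln t" "\<lambda>_. borel"] by simp
  from exponential_distributed_sum[OF _ _ _ _ this, of 1] show ?thesis
    by (simp add: neg_log_vol_def[abs_def] coordinate_exponential)
qed

lemma distr_neg_log_vol: "distr cube_law borel (neg_log_vol :: real^'d \<Rightarrow> real) = gamma_law CARD('d)"
proof -
  have "distr cube_law borel (neg_log_vol :: real^'d \<Rightarrow> real)
      = distr cube_law lborel (neg_log_vol :: real^'d \<Rightarrow> real)"
    by (intro distr_cong) auto
  with distributed_distr_eq_density[OF neg_log_vol_distributed] show ?thesis
    by simp
qed

section \<open>Moments and Laplace transform of the Gamma law\<close>

lemma prob_space_gamma_law: "prob_space (gamma_law d)"
  by (rule prob_space_erlang_density) simp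

lemma gamma_law_moments:
  assumes "0 < d"
  shows "integrable (gamma_law d) (\<lambda>g. g)" "integrable (gamma_law d) (\<lambda>g. g\<^sup>2)"
    and "(\<integral>g. g \<partial>gamma_law d) = real d" "(\<integral>g. g\<^sup>2 \<partial>gamma_law d) = real d * (real d + 1)"
proof -
  interpret prob_space "gamma_law d"
    by (rule prob_space_gamma_law)
  have D: "distributed (gamma_law d) lborel (\<lambda>g. g) (erlang_density (d - 1) 1)"
    unfolding distributed_def by (auto simp: distr_id2 sets_eq_imp_space_eq)
  obtain k where k: "d = Suc k"
    using assms by (cases d) auto
  show "integrable (gamma_law d) (\<lambda>g. g)" "integrable (gamma_law d) (\<lambda>g. g\<^sup>2)"
    using erlang_ith_moment_integrable[OF _ D, of 1] erlang_ith_moment_integrable[OF _ D, of 2] by auto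
  show "(\<integral>g. g \<partial>gamma_law d) = real d" "(\<integral>g. g\<^sup>2 \<partial>gamma_law d) = real d * (real d + 1)"
    using erlang_ith_moment[OF _ D, of 1] erlang_ith_moment[OF _ D, of 2]
    by (auto simp: k algebra_simps add_divide_distrib)
qed

text \<open>The antiderivative is -exp (-z x) / z, which vanishes at infinity since Re z > 0;
  integrability comes from the modulus, a real exponential of rate Re z.\<close>

lemma has_bochner_integral_exp_halfline:
  fixes z :: complex
  assumes z: "0 < Re z"
  shows "has_bochner_integral lborel (\<lambda>x. indicator {0<..} x *\<^sub>R exp (- z * of_real x)) (1 / z)"
proof -
  have nz: "z \<noteq> 0"
    using z by auto
  have "set_integrable lborel {0..} (\<lambda>x. exp (- Re z * x))"
  proof -
    have "integrable lborel (\<lambda>x. exp (- Re z * x) * indicator {0..} x)"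
    proof (rule integrableI_nonneg)
      have "(\<integral>\<^sup>+x. ennreal (exp (- Re z * x)) * indicator {0..} x \<partial>lborel)
          = ennreal (0 - (- exp (- Re z * 0) / Re z))"
      proof (rule nn_integral_FTC_atLeast)
        show "((\<lambda>x. - exp (- Re z * x) / Re z) \<longlongrightarrow> 0) at_top"
          using z by real_asymp
      qed (use z in \<open>auto intro!: derivative_eq_intros\<close>)
      then show "(\<integral>\<^sup>+x. ennreal (exp (- Re z * x) * indicator {0..} x) \<partial>lborel) < \<infinity>"
        by (simp add: ennreal_mult' ennreal_indicator)
    qed auto
    then show ?thesis
      by (simp add: set_integrable_def mult.commute)
  qed
  then have "set_integrable lborel {0<..} (\<lambda>x. exp (- Re z * x))"
    by (rule set_integrable_subset) auto
  then have int: "set_integrable lborel {0<..} (\<lambda>x. exp (- z * of_real x))"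
    unfolding set_integrable_def
    by (rule Bochner_Integration.integrable_bound) (auto simp: indicator_def)
  have "(LBINT x=0..\<infinity>. exp (- z * of_real x)) = 0 - (- 1 / z)"
  proof (rule interval_integral_FTC_integrable[where F="\<lambda>x. - exp (- z * of_real x) / z"])
    fix x :: real
    show "((\<lambda>x. - exp (- z * of_real x) / z) has_vector_derivative exp (- z * of_real x)) (at x)"
      by (rule has_vector_derivative_real_field) (use nz in \<open>auto intro!: derivative_eq_intros\<close>)
    show "isCont (\<lambda>x. exp (- z * of_real x)) x"
      by (intro continuous_intros)
  next
    show "set_integrable lborel (einterval 0 \<infinity>) (\<lambda>x. exp (- z * of_real x))"
      using int by (simp add: einterval_def greaterThan_def zero_ereal_def)
    have "((\<lambda>x. - exp (- z * of_real x) / z) \<longlongrightarrow> - exp (- z * of_real 0) / z) (at_right 0)"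
      by (intro tendsto_intros) (use nz in auto)
    then show "(((\<lambda>x. - exp (- z * of_real x) / z) \<circ> real_of_ereal) \<longlongrightarrow> - 1 / z) (at_right 0)"
      by (simp add: ereal_tendsto_simps zero_ereal_def)
    have "((\<lambda>x. exp (- Re z * x) / cmod z) \<longlongrightarrow> 0) at_top"
      using z nz by real_asymp
    then have "((\<lambda>x. - exp (- z * of_real x) / z) \<longlongrightarrow> 0) at_top"
      by (rule Lim_null_comparison[rotated]) (auto simp: norm_divide)
    then show "(((\<lambda>x. - exp (- z * of_real x) / z) \<circ> real_of_ereal) \<longlongrightarrow> 0) (at_left \<infinity>)"
      by (simp add: ereal_tendsto_simps)
  qed auto
  then have "(\<integral>x. indicator {0<..} x *\<^sub>R exp (- z * of_real x) \<partial>lborel) = 1 / z"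
    by (simp add: interval_lebesgue_integral_def set_lebesgue_integral_def einterval_def greaterThan_def zero_ereal_def)
  with int show ?thesis
    by (simp add: has_bochner_integral_iff set_integrable_def)
qed

text \<open>On the cube the integrand factors over the coordinates, and each independent exponential
  contributes 1 / (1 + s). Complex s is what the characteristic function argument needs.\<close>

lemma has_bochner_integral_gamma_law_cexp:
  fixes s :: complex
  assumes s: "- 1 < Re s"
  shows "has_bochner_integral (gamma_law CARD('d::finite)) (\<lambda>g. exp (- s * of_real g)) (1 / (1 + s) ^ CARD('d))"
proof -
  interpret prob_space "cube_law :: (real^'d) measure"
    by (rule prob_space_cube_law)
  let ?X = "\<lambda>i (x :: real^'d). exp (- s * complex_of_real (- ln (x $ i)))"
  have one: "has_bochner_integral cube_law (?X i) (1 / (1 + s))" for i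
  proof -
    have D: "distr cube_law borel (\<lambda>x::real^'d. - ln (x $ i)) = density lborel (\<lambda>x. ennreal (exponential_density 1 x))"
    proof -
      have "distr cube_law borel (\<lambda>x::real^'d. - ln (x $ i)) = distr cube_law lborel (\<lambda>x::real^'d. - ln (x $ i))"
        by (intro distr_cong) auto
      with distributed_distr_eq_density[OF coordinate_exponential[of i]] show ?thesis
        by simp
    qed
    have "has_bochner_integral lborel (\<lambda>x. exponential_density 1 x *\<^sub>R exp (- s * complex_of_real x)) (1 / (1 + s))"
    proof (rule has_bochner_integral_cong_AE[THEN iffD1, rotated 3])
      show "has_bochner_integral lborel (\<lambda>x. indicator {0<..} x *\<^sub>R exp (- (1 + s) * of_real x)) (1 / (1 + s))"
        \<comment> \<open>The next goal compares two integrands that can differ only at 0, where the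
          exponential density is 1 but the indicator of the open half-line is 0.\<close>
        using s by (intro has_bochner_integral_exp_halfline) simp
      show "AE x in lborel. indicator {0<..} x *\<^sub>R exp (- (1 + s) * of_real x)
          = exponential_density 1 x *\<^sub>R exp (- s * complex_of_real x)"
        using AE_lborel_singleton[of "0::real"]
        by eventually_elim
           (auto simp: erlang_density_def indicator_def scaleR_conv_of_real exp_of_real[symmetric]
             exp_add[symmetric] algebra_simps)
    qed auto
    then have "has_bochner_integral (distr cube_law borel (\<lambda>x::real^'d. - ln (x $ i)))
        (\<lambda>x. exp (- s * complex_of_real x)) (1 / (1 + s))"
      unfolding D by (auto simp: has_bochner_integral_iff integrable_density integral_density erlang_density_nonneg)
    then show ?thesis
      by (auto simp: has_bochner_integral_iff integrable_distr_eq integral_distr)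
  qed
  have ind: "indep_vars (\<lambda>_. borel) ?X UNIV"
    by (rule indep_vars_compose2[OF indep_vars_coordinates]) auto
  have int: "integrable cube_law (?X i)" for i
    using one by (auto simp: has_bochner_integral_iff)
  have prod: "(\<Prod>i\<in>UNIV. ?X i x) = exp (- s * complex_of_real (neg_log_vol x))" for x
    by (simp add: neg_log_vol_def exp_sum[symmetric] sum_distrib_left sum_negf)
  have "has_bochner_integral cube_law (\<lambda>x. exp (- s * complex_of_real (neg_log_vol (x :: real^'d))))
      (1 / (1 + s) ^ CARD('d))"
    using indep_vars_lebesgue_integral[OF finite ind int, unfolded prod]
      indep_vars_integrable[OF finite ind int, unfolded prod] one[THEN has_bochner_integral_integral_eq]
    by (simp add: has_bochner_integral_iff power_divide)
  then show ?thesis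
    unfolding distr_neg_log_vol[symmetric, where 'd='d]
    by (auto simp: has_bochner_integral_iff integrable_distr_eq integral_distr)
qed

lemma has_bochner_integral_gamma_law_exp:
  fixes s :: real
  assumes s: "- 1 < s"
  shows "has_bochner_integral (gamma_law CARD('d::finite)) (\<lambda>g. exp (- s * g)) (1 / (1 + s) ^ CARD('d))"
proof -
  have "has_bochner_integral (gamma_law CARD('d)) (\<lambda>g. complex_of_real (exp (- s * g)))
      (complex_of_real (1 / (1 + s) ^ CARD('d)))"
    using has_bochner_integral_gamma_law_cexp[of "of_real s", where 'd='d] s
    by (simp add: exp_of_real[symmetric])
  then show ?thesis
    unfolding has_bochner_integral_iff complex_of_real_integrable_eq integral_complex_of_real of_real_eq_iff .
qed

section \<open>Scaling of boxes and the transition at a record\<close>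

lemma nn_integral_lborel_vec_scale:
  fixes r :: "real ^ 'd"
  assumes r: "\<And>i. 0 < r $ i" and [measurable]: "f \<in> borel_measurable borel"
  shows "(\<integral>\<^sup>+x. f x \<partial>lborel) = ennreal (\<Prod>i\<in>UNIV. r $ i) * (\<integral>\<^sup>+x. f (\<chi> i. r $ i * x $ i) \<partial>lborel)"
proof -
  let ?T = "\<lambda>x. 0 + (\<Sum>j\<in>Basis. ((r \<bullet> j) * (x \<bullet> j)) *\<^sub>R j)"
  have inj: "inj (\<lambda>i. axis i 1 :: real^'d)"
    by (auto simp: inj_on_def axis_eq_axis)
  have Basis: "(Basis :: (real^'d) set) = range (\<lambda>i. axis i 1)"
    by (auto simp: Basis_vec_def)
  have T: "?T x = (\<chi> i. r $ i * x $ i)" for x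
  proof -
    have "?T x $ i = r $ i * x $ i" for i
      using inner_sum_left_Basis[of "axis i 1 :: real^'d" "\<lambda>j. (r \<bullet> j) * (x \<bullet> j)"]
      by (simp add: inner_axis)
    then show ?thesis
      by (simp add: vec_eq_iff)
  qed
  have p: "(\<Prod>j\<in>Basis. \<bar>r \<bullet> j\<bar>) = (\<Prod>i\<in>UNIV. r $ i)"
    unfolding Basis by (subst prod.reindex[OF inj]) (use r in \<open>auto simp: inner_axis less_imp_le\<close>)
  have [measurable]: "(\<lambda>x. \<chi> i. r $ i * x $ i) \<in> borel_measurable borel"
    unfolding T[symmetric] by measurable
  have "\<And>j. j \<in> Basis \<Longrightarrow> r \<bullet> j \<noteq> 0"
    using r by (auto simp: Basis_vec_def inner_axis less_imp_neq[symmetric])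
  from lborel_affine_euclidean[where c="\<lambda>j. r \<bullet> j" and t=0, OF this]
  have "lborel = density (distr lborel borel (\<lambda>x. \<chi> i. r $ i * x $ i)) (\<lambda>_. ennreal (\<Prod>i\<in>UNIV. r $ i))"
    unfolding T p by simp
  then have "(\<integral>\<^sup>+x. f x \<partial>lborel)
      = (\<integral>\<^sup>+x. f x \<partial>density (distr lborel borel (\<lambda>x. \<chi> i. r $ i * x $ i)) (\<lambda>_. ennreal (\<Prod>i\<in>UNIV. r $ i)))"
    by simp
  also have "\<dots> = ennreal (\<Prod>i\<in>UNIV. r $ i) * (\<integral>\<^sup>+x. f (\<chi> i. r $ i * x $ i) \<partial>lborel)"
    by (simp add: nn_integral_density nn_integral_distr nn_integral_cmult)
  finally show ?thesis .
qed

lemma exp_neg_log_vol: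
  fixes r :: "real ^ 'd"
  assumes "\<And>i. 0 < r $ i"
  shows "exp (- neg_log_vol r) = (\<Prod>i\<in>UNIV. r $ i)"
  using assms by (simp add: neg_log_vol_def sum_negf exp_sum)

lemma AE_lborel_component_neq:
  "AE x in lborel. (x :: real ^ 'd) $ i \<noteq> c"
proof -
  have "{x :: real^'d. x $ i = c} = {x. axis i 1 \<bullet> x = c}"
    by (simp add: inner_axis')
  then have "negligible {x :: real^'d. x $ i = c}"
    using negligible_hyperplane[of "axis i (1::real) :: real^'d" c] by (simp add: axis_eq_0_iff)
  then have "{x :: real^'d. x $ i = c} \<in> null_sets lebesgue"
    by (simp add: negligible_iff_null_sets)
  then have "{x :: real^'d. x $ i = c} \<in> null_sets lborel"
    by (subst (asm) null_sets_completion_iff) auto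
  then show ?thesis
    by (rule AE_I') auto
qed

text \<open>Self-similarity: the diagonal scaling from the unit cube to the box below r multiplies
  Lebesgue measure by the volume of that box and shifts \<open>neg_log_vol\<close> by
  \<open>neg_log_vol r\<close>. Thus a point falling below r adds a Gamma variable whose law does
  not depend on r.\<close>

lemma distr_neg_log_vol_cbox:
  fixes r :: "real ^ 'd"
  assumes r: "\<And>i. 0 < r $ i"
  shows "distr (density lborel (\<lambda>x. ennreal (indicator (cbox 0 r) x))) borel neg_log_vol
    = density (distr (gamma_law CARD('d)) borel (\<lambda>g. neg_log_vol r + g)) (\<lambda>_. ennreal (exp (- neg_log_vol r)))"
    (is "?L = ?R")
proof (rule measure_eqI)
  fix A assume "A \<in> sets ?L"
  then have [measurable]: "A \<in> sets borel"
    by simp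
  have cube: "cube_law = density lborel (\<lambda>x::real^'d. ennreal (indicator (cbox 0 1) x))"
    by (simp add: uniform_measure_def divide_ennreal_def ennreal_indicator)
  have "emeasure ?L A = emeasure (density lborel (\<lambda>x. ennreal (indicator (cbox 0 r) x))) (neg_log_vol -` A)"
    by (subst emeasure_distr) auto
  also have "\<dots> = (\<integral>\<^sup>+x. ennreal (indicator (cbox 0 r) x) * indicator A (neg_log_vol x) \<partial>lborel)"
    using measurable_sets[OF measurable_neg_log_vol, of A]
    by (subst emeasure_density) (auto intro!: nn_integral_cong simp: indicator_def)
  also have "\<dots> = ennreal (exp (- neg_log_vol r)) *
      (\<integral>\<^sup>+x. ennreal (indicator (cbox 0 r) (\<chi> i. r $ i * x $ i)) * indicator A (neg_log_vol (\<chi> i. r $ i * x $ i)) \<partial>lborel)"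
    using r by (subst nn_integral_lborel_vec_scale[OF r]) (auto simp: exp_neg_log_vol)
  also have "(\<integral>\<^sup>+x. ennreal (indicator (cbox 0 r) (\<chi> i. r $ i * x $ i)) * indicator A (neg_log_vol (\<chi> i. r $ i * x $ i)) \<partial>lborel)
     = (\<integral>\<^sup>+x. ennreal (indicator (cbox 0 1) x) * indicator A (neg_log_vol r + neg_log_vol x) \<partial>(lborel :: (real^'d) measure))"
  proof (rule nn_integral_cong_AE)
    \<comment> \<open>Zero coordinates are discarded because \<open>ln (r $ i * x $ i)\<close>
      splits into a sum only for positive factors.\<close>
    have "AE x in lborel. \<forall>i. (x :: real^'d) $ i \<noteq> 0"
      using AE_lborel_component_neq by (subst AE_all_countable) auto
    then show "AE x in lborel. ennreal (indicator (cbox 0 r) (\<chi> i. r $ i * x $ i)) * indicator A (neg_log_vol (\<chi> i. r $ i * x $ i))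
        = ennreal (indicator (cbox 0 1) x) * indicator A (neg_log_vol r + neg_log_vol (x :: real^'d))"
    proof eventually_elim
      case (elim x)
      have "(\<chi> i. r $ i * x $ i) \<in> cbox 0 r \<longleftrightarrow> x \<in> cbox 0 1"
        using r by (simp add: mem_box_cart zero_le_mult_iff less_imp_le not_le[symmetric])
      moreover have "neg_log_vol (\<chi> i. r $ i * x $ i) = neg_log_vol r + neg_log_vol x" if "x \<in> cbox 0 1"
      proof -
        have "0 < x $ i" for i
          using that elim by (auto simp: mem_box_cart order_less_le)
        then show ?thesis
          using r by (simp add: neg_log_vol_def ln_mult_pos sum.distrib[symmetric])
      qed
      ultimately show ?case
        by (auto simp: indicator_def)
    qed
  qed
  also have "\<dots> = (\<integral>\<^sup>+x. indicator A (neg_log_vol r + neg_log_vol x) \<partial>(cube_law :: (real^'d) measure))"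
    unfolding cube by (subst nn_integral_density) auto
  also have "\<dots> = (\<integral>\<^sup>+g. indicator A (neg_log_vol r + g) \<partial>distr cube_law borel (neg_log_vol :: real^'d \<Rightarrow> real))"
    by (subst nn_integral_distr) auto
  also have "\<dots> = (\<integral>\<^sup>+g. indicator A (neg_log_vol r + g) \<partial>gamma_law CARD('d))"
    unfolding distr_neg_log_vol ..
  also have "\<dots> = emeasure (distr (gamma_law CARD('d)) borel (\<lambda>g. neg_log_vol r + g)) A"
    by (subst nn_integral_indicator[symmetric]) (auto simp: nn_integral_distr simp del: nn_integral_indicator)
  also have "ennreal (exp (- neg_log_vol r)) * \<dots> = emeasure ?R A"
    by (subst emeasure_density) (auto simp: nn_integral_cmult)
  finally show "emeasure ?L A = emeasure ?R A" .
qed simp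

text \<open>The transition of the chain from record r. Up to null sets the new mark is a record
  exactly when it lies in \<open>cbox 0 r\<close>, so the integrand is c plus a correction supported
  on that box, to which the scaling law applies. The assumption r = 1 at n = 0 makes the
  unconditional first record obey the same rule.\<close>

lemma has_bochner_integral_record_step:
  fixes r :: "real ^ 'd" and a :: "real \<Rightarrow> 'b :: {banach, second_countable_topology}" and c :: 'b
  defines "v \<equiv> exp (- neg_log_vol r)"
  assumes r: "\<And>i. 0 < r $ i" "\<And>i. r $ i \<le> 1" and n: "n = 0 \<Longrightarrow> r = 1"
    and [measurable]: "a \<in> borel_measurable borel"
    and int: "integrable (gamma_law CARD('d)) (\<lambda>g. a (neg_log_vol r + g))"
  shows "has_bochner_integral cube_law (\<lambda>x. if n = (0::nat) \<or> x \<prec> r then a (neg_log_vol x) else c)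
    ((1 - v) *\<^sub>R c + v *\<^sub>R (\<integral>g. a (neg_log_vol r + g) \<partial>gamma_law CARD('d)))"
proof -
  interpret prob_space "cube_law :: (real^'d) measure"
    by (rule prob_space_cube_law)
  interpret G: prob_space "gamma_law CARD('d)"
    by (rule prob_space_gamma_law)
  let ?b = "\<lambda>l. a l - c"
  have cube: "cube_law = density lborel (\<lambda>x::real^'d. ennreal (indicator (cbox 0 1) x))"
    by (simp add: uniform_measure_def divide_ennreal_def ennreal_indicator)
  have "has_bochner_integral (gamma_law CARD('d)) (\<lambda>g. ?b (neg_log_vol r + g))
      ((\<integral>g. a (neg_log_vol r + g) \<partial>gamma_law CARD('d)) - c)"
    using has_bochner_integral_diff[OF has_bochner_integral_integrable[OF int]
        has_bochner_integral_integrable[OF G.integrable_const[of c]]] G.prob_space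
    by simp
  then have "has_bochner_integral (distr (density lborel (\<lambda>x. ennreal (indicator (cbox 0 r) x))) borel neg_log_vol) ?b
      (v *\<^sub>R ((\<integral>g. a (neg_log_vol r + g) \<partial>gamma_law CARD('d)) - c))"
    unfolding distr_neg_log_vol_cbox[OF r(1)] v_def
    by (auto simp: has_bochner_integral_iff integrable_density integral_density integrable_distr_eq integral_distr)
  then have lb: "has_bochner_integral lborel (\<lambda>x. indicator (cbox 0 r) x *\<^sub>R ?b (neg_log_vol x))
      (v *\<^sub>R ((\<integral>g. a (neg_log_vol r + g) \<partial>gamma_law CARD('d)) - c))"
    by (auto simp: has_bochner_integral_iff integrable_density integral_density integrable_distr_eq integral_distr)
  \<comment> \<open>The box below r lies in the unit cube, so the density of the uniform law is 1 on
    it.\<close>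
  have sub: "indicator (cbox 0 1) x *\<^sub>R indicator (cbox 0 r) x *\<^sub>R y = indicator (cbox 0 r) x *\<^sub>R y"
    for x :: "real^'d" and y :: 'b
    using r by (auto simp: indicator_def mem_box_cart) (meson order.trans)
  have "has_bochner_integral cube_law (\<lambda>x. indicator (cbox 0 r) x *\<^sub>R ?b (neg_log_vol x))
      (v *\<^sub>R ((\<integral>g. a (neg_log_vol r + g) \<partial>gamma_law CARD('d)) - c))"
    unfolding cube using lb
    by (auto simp: has_bochner_integral_iff integrable_density integral_density sub simp del: scaleR_scaleR)
  moreover have "has_bochner_integral cube_law (\<lambda>_ :: real^'d. c) c"
    using has_bochner_integral_integrable[OF integrable_const[of c]] prob_space
    by (simp del: measure_uniform_measure)
  ultimately have "has_bochner_integral cube_law (\<lambda>x. c + indicator (cbox 0 r) x *\<^sub>R ?b (neg_log_vol x))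
      (c + v *\<^sub>R ((\<integral>g. a (neg_log_vol r + g) \<partial>gamma_law CARD('d)) - c))"
    by (intro has_bochner_integral_add)
  also have "c + v *\<^sub>R ((\<integral>g. a (neg_log_vol r + g) \<partial>gamma_law CARD('d)) - c)
      = (1 - v) *\<^sub>R c + v *\<^sub>R (\<integral>g. a (neg_log_vol r + g) \<partial>gamma_law CARD('d))"
    by (simp add: algebra_simps)
  finally show ?thesis
  proof (rule has_bochner_integral_cong_AE[THEN iffD1, rotated 3])
    have "AE x in cube_law. x \<in> cbox 0 (1 :: real^'d)"
      by (rule AE_uniform_measureI) auto
    \<comment> \<open>The relation \<prec> excludes equality while \<open>cbox 0 r\<close> contains
      r; this single point is null.\<close>
    moreover have "AE x in cube_law. x \<noteq> r"
      unfolding cube using AE_lborel_singleton[of r] by (auto simp: AE_density)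
    ultimately show "AE x in cube_law. c + indicator (cbox 0 r) x *\<^sub>R ?b (neg_log_vol x)
        = (if n = 0 \<or> x \<prec> r then a (neg_log_vol x) else c)"
    proof eventually_elim
      case (elim x)
      have "n = 0 \<or> x \<prec> r \<longleftrightarrow> x \<in> cbox 0 r"
        using elim n by (auto simp: strictly_below_def mem_box_cart)
      then show ?case
        by auto
    qed
  qed (auto simp: strictly_below_def[abs_def])
qed

subsection \<open>The Markov chain of records\<close>

text \<open>Only the marks 1..n matter, so the state at time n is independent of mark n + 1.\<close>

lemma current_record_cong:
  assumes "\<And>i. i \<in> {1..n} \<Longrightarrow> x i = y i"
  shows "current_record x n = current_record y n"
  using assms by (induction n) auto

lemma record_count_cong:
  assumes "\<And>i. i \<in> {1..n} \<Longrightarrow> x i = y i"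
  shows "record_count x n = record_count y n"
  using assms
proof (induction n)
  case (Suc n)
  then show ?case
    using current_record_cong[of n x y] by simp
qed simp

lemma measurable_strictly_below [measurable (raw)]:
  fixes f g :: "'a \<Rightarrow> real ^ 'd"
  assumes [measurable]: "f \<in> borel_measurable N" "g \<in> borel_measurable N"
  shows "Measurable.pred N (\<lambda>\<omega>. f \<omega> \<prec> g \<omega>)"
proof -
  have [measurable]: "(\<lambda>\<omega>. f \<omega> $ i) \<in> borel_measurable N" "(\<lambda>\<omega>. g \<omega> $ i) \<in> borel_measurable N" for i
    by (rule measurable_compose[OF assms(1)] measurable_compose[OF assms(2)], measurable)+
  \<comment> \<open>Given the weak inequalities, being different means being strictly smaller
    somewhere; only coordinate comparisons over a finite index set remain.\<close>
  have eq: "f \<omega> \<prec> g \<omega> \<longleftrightarrow> (\<forall>i\<in>UNIV. f \<omega> $ i \<le> g \<omega> $ i) \<and> (\<exists>i\<in>UNIV. f \<omega> $ i < g \<omega> $ i)" for \<omega>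
    by (force simp: strictly_below_def vec_eq_iff order_less_le)
  show ?thesis
    unfolding eq by measurable
qed

lemma measurable_current_record:
  fixes Y :: "nat \<Rightarrow> 'a \<Rightarrow> real ^ 'd"
  assumes "\<And>i. i \<in> {1..n} \<Longrightarrow> Y i \<in> borel_measurable N"
  shows "(\<lambda>\<omega>. current_record (\<lambda>i. Y i \<omega>) n) \<in> borel_measurable N"
  using assms
proof (induction n)
  case (Suc n)
  then have [measurable]: "Y (Suc n) \<in> borel_measurable N"
      "(\<lambda>\<omega>. current_record (\<lambda>i. Y i \<omega>) n) \<in> borel_measurable N"
    by auto
  show ?case
    unfolding current_record.simps by measurable
qed simp

lemma measurable_record_count:
  fixes Y :: "nat \<Rightarrow> 'a \<Rightarrow> real ^ 'd"
  assumes "\<And>i. i \<in> {1..n} \<Longrightarrow> Y i \<in> borel_measurable N"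
  shows "(\<lambda>\<omega>. record_count (\<lambda>i. Y i \<omega>) n) \<in> measurable N (count_space UNIV)"
  using assms
proof (induction n)
  case (Suc n)
  then have [measurable]: "Y (Suc n) \<in> borel_measurable N"
      "(\<lambda>\<omega>. record_count (\<lambda>i. Y i \<omega>) n) \<in> measurable N (count_space UNIV)"
    by auto
  have [measurable]: "(\<lambda>\<omega>. current_record (\<lambda>i. Y i \<omega>) n) \<in> borel_measurable N"
    using Suc.prems by (intro measurable_current_record) auto
  show ?case
    unfolding record_count.simps by measurable
qed simp

lemma record_count_le: "record_count x n \<le> n"
  by (induction n) auto

lemma current_record_bounds:
  fixes x :: "nat \<Rightarrow> real ^ 'd"
  assumes "\<And>i j. 1 \<le> i \<Longrightarrow> 0 < x i $ j \<and> x i $ j \<le> 1"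
  shows "0 < current_record x n $ j \<and> current_record x n $ j \<le> 1"
  using assms by (induction n) auto

lemma neg_log_vol_nonneg:
  fixes r :: "real ^ 'd"
  assumes "\<And>i. 0 < r $ i" "\<And>i. r $ i \<le> 1"
  shows "0 \<le> neg_log_vol r"
  unfolding neg_log_vol_def using assms by (intro sum_nonneg) simp

text \<open>The value of F after one more mark, as a function of the pair (old state, new mark).
  Separating the past from the fresh mark prepares for Fubini's theorem.\<close>

definition step_value :: "(nat \<Rightarrow> real \<Rightarrow> 'b) \<Rightarrow> nat \<Rightarrow> (nat \<times> (real ^ 'd)) \<times> (real ^ 'd) \<Rightarrow> 'b" where
  "step_value F n p = (if n = 0 \<or> snd p \<prec> snd (fst p) then F (Suc (fst (fst p))) (neg_log_vol (snd p))
            else F (fst (fst p)) (neg_log_vol (snd (fst p))))"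

lemma measurable_step_value:
  assumes F: "\<And>k. F k \<in> borel_measurable borel"
  shows "step_value F n \<in> borel_measurable ((count_space UNIV \<Otimes>\<^sub>M borel) \<Otimes>\<^sub>M borel)"
    (is "_ \<in> borel_measurable ?S")
proof -
  have k: "(\<lambda>p. fst (fst p)) \<in> measurable ?S (count_space UNIV)"
    by (rule measurable_compose[OF measurable_fst measurable_fst])
  have r: "(\<lambda>p. snd (fst p)) \<in> borel_measurable ?S"
    by (rule measurable_compose[OF measurable_fst measurable_snd])
  have "(\<lambda>p. F (Suc (fst (fst p))) (neg_log_vol (snd p))) \<in> borel_measurable ?S"
    by (rule measurable_compose_countable[OF _ k])
       (rule measurable_compose[OF measurable_compose[OF measurable_snd measurable_neg_log_vol] F])
  moreover have "(\<lambda>p. F (fst (fst p)) (neg_log_vol (snd (fst p)))) \<in> borel_measurable ?S"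
    by (rule measurable_compose_countable[OF _ k])
       (rule measurable_compose[OF measurable_compose[OF r measurable_neg_log_vol] F])
  moreover have "Measurable.pred ?S (\<lambda>p. n = 0 \<or> snd p \<prec> snd (fst p))"
    using measurable_strictly_below[OF measurable_snd r] by (cases "n = 0") simp_all
  ultimately show ?thesis
    unfolding step_value_def[abs_def] pred_def by (rule measurable_If)
qed

lemma measurable_gamma_integral:
  fixes F :: "nat \<Rightarrow> real \<Rightarrow> 'b :: {banach, second_countable_topology}"
  assumes [measurable]: "\<And>k. F k \<in> borel_measurable borel"
    and [measurable]: "f \<in> measurable N (count_space UNIV)" "h \<in> borel_measurable N"
  shows "(\<lambda>\<omega>. \<integral>g. F (f \<omega>) (h \<omega> + g) \<partial>gamma_law d) \<in> borel_measurable N"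
proof -
  interpret G: prob_space "gamma_law d"
    by (rule prob_space_gamma_law)
  have "(\<lambda>l. \<integral>g. F k (l + g) \<partial>gamma_law d) \<in> borel_measurable borel" for k
    by measurable
  from measurable_compose[OF assms(3) this] show ?thesis
    by (rule measurable_compose_countable[OF _ assms(2)])
qed

lemma has_bochner_integral_step_value:
  fixes F :: "nat \<Rightarrow> real \<Rightarrow> 'b :: {banach, second_countable_topology}" and r :: "real ^ 'd"
  assumes "\<And>k. F k \<in> borel_measurable borel"
    and "\<And>k l. integrable (gamma_law CARD('d)) (\<lambda>g. F k (l + g))"
    and "\<And>i. 0 < r $ i" "\<And>i. r $ i \<le> 1" "n = 0 \<Longrightarrow> r = 1"
  shows "has_bochner_integral cube_law (\<lambda>x. step_value F n ((k, r), x))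
    ((1 - exp (- neg_log_vol r)) *\<^sub>R F k (neg_log_vol r)
      + exp (- neg_log_vol r) *\<^sub>R (\<integral>g. F (Suc k) (neg_log_vol r + g) \<partial>gamma_law CARD('d)))"
  unfolding step_value_def fst_conv snd_conv
  by (rule has_bochner_integral_record_step) (use assms in auto)

section \<open>The random chain and its one-step expectations\<close>

locale uniform_marks = prob_space M for M :: "'a measure" +
  fixes X :: "nat \<Rightarrow> 'a \<Rightarrow> real ^ 'd"
  assumes indep_marks: "indep_vars (\<lambda>_. borel) X {1..}"
    and uniform_mark: "\<And>i. i \<ge> 1 \<Longrightarrow> distr M borel (X i) = cube_law"
begin

definition rec_num :: "nat \<Rightarrow> 'a \<Rightarrow> nat" where
  "rec_num n \<omega> = record_count (\<lambda>i. X i \<omega>) n"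

definition rec_val :: "nat \<Rightarrow> 'a \<Rightarrow> real ^ 'd" where
  "rec_val n \<omega> = current_record (\<lambda>i. X i \<omega>) n"

definition neg_log :: "nat \<Rightarrow> 'a \<Rightarrow> real" where
  "neg_log n \<omega> = neg_log_vol (rec_val n \<omega>)"

lemma measurable_mark: "i \<ge> 1 \<Longrightarrow> X i \<in> borel_measurable M"
  using indep_marks by (auto simp: indep_vars_def)

lemma measurable_rec_num [measurable]: "rec_num n \<in> measurable M (count_space UNIV)"
  unfolding rec_num_def[abs_def] by (intro measurable_record_count measurable_mark) auto

lemma measurable_rec_val [measurable]: "rec_val n \<in> borel_measurable M"
  unfolding rec_val_def[abs_def] by (intro measurable_current_record measurable_mark) auto

lemma measurable_neg_log [measurable]: "neg_log n \<in> borel_measurable M"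
  unfolding neg_log_def[abs_def] by measurable

lemma rec_num_le: "rec_num n \<omega> \<le> n"
  by (simp add: rec_num_def record_count_le)

text \<open>Almost surely no mark has a zero coordinate; countably many marks keep the exceptional
  set null, and every record inherits the bounds from the marks or from the initial value 1.\<close>

lemma AE_rec_val_bounds: "AE \<omega> in M. \<forall>n j. 0 < rec_val n \<omega> $ j \<and> rec_val n \<omega> $ j \<le> 1"
proof -
  have cube: "AE x in cube_law. \<forall>j. 0 < (x :: real^'d) $ j \<and> x $ j \<le> 1"
  proof -
    have "AE x in lborel. \<forall>i. (x :: real^'d) $ i \<noteq> 0"
      using AE_lborel_component_neq by (subst AE_all_countable) auto
    then have "AE x in lborel. x \<in> cbox 0 1 \<longrightarrow> (\<forall>j. 0 < (x :: real^'d) $ j \<and> x $ j \<le> 1)"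
      by eventually_elim (auto simp: mem_box_cart order_less_le)
    then show ?thesis
      by (intro AE_uniform_measureI) auto
  qed
  have "AE \<omega> in M. \<forall>j. 0 < X i \<omega> $ j \<and> X i \<omega> $ j \<le> 1" if i: "i \<ge> 1" for i
  proof -
    have "AE x in distr M borel (X i). \<forall>j. 0 < x $ j \<and> x $ j \<le> 1"
      unfolding uniform_mark[OF i] by (rule cube)
    then show ?thesis
      by (subst (asm) AE_distr_iff) (auto intro: measurable_mark[OF i])
  qed
  then have "AE \<omega> in M. \<forall>i. 1 \<le> i \<longrightarrow> (\<forall>j. 0 < X i \<omega> $ j \<and> X i \<omega> $ j \<le> 1)"
    by (subst AE_all_countable) auto
  then show ?thesis
  proof eventually_elim
    case (elim \<omega>)
    then show ?case
      using current_record_bounds[of "\<lambda>i. X i \<omega>"] by (simp add: rec_val_def)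
  qed
qed

lemma AE_neg_log_nonneg: "AE \<omega> in M. \<forall>n. 0 \<le> neg_log n \<omega>"
  using AE_rec_val_bounds by eventually_elim (auto simp: neg_log_def intro!: neg_log_vol_nonneg)

abbreviation state_space :: "(nat \<times> (real ^ 'd)) measure" where
  "state_space \<equiv> count_space UNIV \<Otimes>\<^sub>M borel"

text \<open>The state is a measurable function of the marks 1..n, and the marks with indices in the
  disjoint sets {1..n} and {n + 1} form independent blocks; hence the joint law is a
  product.\<close>

lemma joint_law:
  "distr M (state_space \<Otimes>\<^sub>M borel) (\<lambda>\<omega>. ((rec_num n \<omega>, rec_val n \<omega>), X (Suc n) \<omega>))
    = distr M state_space (\<lambda>\<omega>. (rec_num n \<omega>, rec_val n \<omega>)) \<Otimes>\<^sub>M cube_law"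
proof -
  define I where "I = {1..n}"
  let ?P = "PiM I (\<lambda>_. borel :: (real^'d) measure)" and ?Q = "PiM {Suc n} (\<lambda>_. borel :: (real^'d) measure)"
  let ?Y = "\<lambda>x :: nat \<Rightarrow> real^'d. (record_count x n, current_record x n)" and ?Z = "\<lambda>x :: nat \<Rightarrow> real^'d. x (Suc n)"
  let ?A = "\<lambda>\<omega>. restrict (\<lambda>i. X i \<omega>) I" and ?B = "\<lambda>\<omega>. restrict (\<lambda>i. X i \<omega>) {Suc n}"
  have mY [measurable]: "?Y \<in> measurable ?P state_space"
    by (intro measurable_Pair measurable_record_count[where Y="\<lambda>i x. x i"]
        measurable_current_record[where Y="\<lambda>i x. x i"]) (auto simp: I_def)
  have mZ [measurable]: "?Z \<in> measurable ?Q borel"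
    by auto
  have indep: "indep_var ?P ?A ?Q ?B"
    by (intro indep_var_restrict[OF indep_marks]) (auto simp: I_def)
  have mA: "?A \<in> measurable M ?P" and mB: "?B \<in> measurable M ?Q"
    and joint: "distr M ?P ?A \<Otimes>\<^sub>M distr M ?Q ?B = distr M (?P \<Otimes>\<^sub>M ?Q) (\<lambda>\<omega>. (?A \<omega>, ?B \<omega>))"
    using indep[unfolded indep_var_distribution_eq] by blast+
  have "record_count (?A \<omega>) n = rec_num n \<omega>" for \<omega>
    unfolding rec_num_def by (rule record_count_cong) (simp add: I_def)
  moreover have "current_record (?A \<omega>) n = rec_val n \<omega>" for \<omega>
    unfolding rec_val_def by (rule current_record_cong) (simp add: I_def)
  moreover have "?B \<omega> (Suc n) = X (Suc n) \<omega>" for \<omega>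
    by simp
  ultimately have YZ: "?Y (?A \<omega>) = (rec_num n \<omega>, rec_val n \<omega>)" "?Z (?B \<omega>) = X (Suc n) \<omega>" for \<omega>
    by (simp_all only:)
  have dY: "distr (distr M ?P ?A) state_space ?Y = distr M state_space (\<lambda>\<omega>. (rec_num n \<omega>, rec_val n \<omega>))"
    by (simp only: distr_distr[OF mY mA] comp_def YZ)
  have dZ: "distr (distr M ?Q ?B) borel ?Z = cube_law"
    using uniform_mark[of "Suc n"] by (simp add: distr_distr[OF mZ mB] comp_def)
  have mYZ: "(\<lambda>(x, y). (?Y x, ?Z y)) \<in> measurable (?P \<Otimes>\<^sub>M ?Q) (state_space \<Otimes>\<^sub>M borel)"
    unfolding case_prod_beta
    by (intro measurable_Pair measurable_compose[OF measurable_fst mY[unfolded measurable_pair_iff comp_def fst_conv snd_conv, THEN conjunct1]]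
      measurable_compose[OF measurable_fst mY[unfolded measurable_pair_iff comp_def fst_conv snd_conv, THEN conjunct2]]
      measurable_compose[OF measurable_snd mZ])
  have "distr M (state_space \<Otimes>\<^sub>M borel) (\<lambda>\<omega>. ((rec_num n \<omega>, rec_val n \<omega>), X (Suc n) \<omega>))
      = distr (distr M (?P \<Otimes>\<^sub>M ?Q) (\<lambda>\<omega>. (?A \<omega>, ?B \<omega>))) (state_space \<Otimes>\<^sub>M borel) (\<lambda>(x, y). (?Y x, ?Z y))"
    by (simp only: distr_distr[OF mYZ measurable_Pair[OF mA mB]] comp_def case_prod_conv YZ)
  also have "\<dots> = distr (distr M ?P ?A) state_space ?Y \<Otimes>\<^sub>M distr (distr M ?Q ?B) borel ?Z"
    unfolding joint[symmetric]
  proof (rule pair_measure_distr[symmetric])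
    show "sigma_finite_measure (distr (distr M ?Q ?B) borel ?Z)"
      unfolding dZ by (intro prob_space_imp_sigma_finite prob_space_cube_law)
  qed (simp_all only: measurable_distr_eq1 mY mZ)
  finally show ?thesis
    unfolding dY dZ .
qed

lemma step_value_state:
  "step_value F n ((rec_num n \<omega>, rec_val n \<omega>), X (Suc n) \<omega>) = F (rec_num (Suc n) \<omega>) (neg_log (Suc n) \<omega>)"
  by (simp add: step_value_def rec_num_def rec_val_def neg_log_def)

lemma AE_state:
  "AE y in distr M state_space (\<lambda>\<omega>. (rec_num n \<omega>, rec_val n \<omega>)).
    (\<forall>i\<in>UNIV. 0 < snd y $ i \<and> snd y $ i \<le> 1) \<and> (n = 0 \<longrightarrow> snd y = 1)"
proof (subst AE_distr_iff)
  have [measurable]: "(\<lambda>y. snd y $ i) \<in> borel_measurable state_space" for i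
    by (rule measurable_compose[OF measurable_snd]) measurable
  show "{y \<in> space state_space. (\<forall>i\<in>UNIV. 0 < snd y $ i \<and> snd y $ i \<le> 1) \<and> (n = 0 \<longrightarrow> snd y = 1)} \<in> sets state_space"
    by measurable
  show "AE \<omega> in M. (\<forall>i\<in>UNIV. 0 < snd (rec_num n \<omega>, rec_val n \<omega>) $ i \<and> snd (rec_num n \<omega>, rec_val n \<omega>) $ i \<le> 1)
      \<and> (n = 0 \<longrightarrow> snd (rec_num n \<omega>, rec_val n \<omega>) = 1)"
    using AE_rec_val_bounds by eventually_elim (auto simp: rec_val_def)
qed measurable

context
  fixes F :: "nat \<Rightarrow> real \<Rightarrow> 'b :: {banach, second_countable_topology}"
  assumes measurable_F [measurable]: "\<And>k. F k \<in> borel_measurable borel"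
    and integrable_F: "\<And>k l. integrable (gamma_law CARD('d)) (\<lambda>g. F k (l + g))"
begin

text \<open>Fubini for the norm: integrating out the fresh mark leaves (1 - V) |F| plus the second
  assumption's integrand, where V = exp (-L). The first term is at most |F| because 0 \<le> V \<le>
  1 almost surely.\<close>

lemma step_integrable:
  assumes F_int: "integrable M (\<lambda>\<omega>. F (rec_num n \<omega>) (neg_log n \<omega>))"
    and G_int: "integrable M (\<lambda>\<omega>. exp (- neg_log n \<omega>) * (\<integral>g. norm (F (Suc (rec_num n \<omega>)) (neg_log n \<omega> + g)) \<partial>gamma_law CARD('d)))"
  shows "integrable M (\<lambda>\<omega>. F (rec_num (Suc n) \<omega>) (neg_log (Suc n) \<omega>))"
proof -
  let ?J = "distr M state_space (\<lambda>\<omega>. (rec_num n \<omega>, rec_val n \<omega>))"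
  let ?N = "\<lambda>k l. norm (F k l)"
  interpret J: prob_space ?J
    by (rule prob_space_distr) measurable
  interpret C: prob_space "cube_law :: (real ^ 'd) measure"
    by (rule prob_space_cube_law)
  interpret P: pair_sigma_finite ?J "cube_law :: (real ^ 'd) measure" ..
  have mN: "\<And>k. ?N k \<in> borel_measurable borel"
    by measurable
  have iN: "integrable (gamma_law CARD('d)) (\<lambda>g. ?N k (l + g))" for k l
    using integrable_F by auto
  let ?I = "\<lambda>y. (1 - exp (- neg_log_vol (snd y))) *\<^sub>R ?N (fst y) (neg_log_vol (snd y))
      + exp (- neg_log_vol (snd y)) *\<^sub>R (\<integral>g. ?N (Suc (fst y)) (neg_log_vol (snd y) + g) \<partial>gamma_law CARD('d))"
  have norm_step: "norm (step_value F n p) = step_value ?N n p" for p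
    by (simp add: step_value_def)
  have mS [measurable]: "step_value F n \<in> borel_measurable (state_space \<Otimes>\<^sub>M borel)"
    by (rule measurable_step_value) measurable
  have [measurable]: "(\<lambda>y. \<integral>g. ?N (Suc (fst y)) (neg_log_vol (snd y) + g) \<partial>gamma_law CARD('d)) \<in> borel_measurable state_space"
    by (rule measurable_gamma_integral) measurable
  have mKR [measurable]: "(\<lambda>\<omega>. (rec_num n \<omega>, rec_val n \<omega>)) \<in> measurable M state_space"
    by measurable
  have mXY: "(\<lambda>\<omega>. ((rec_num n \<omega>, rec_val n \<omega>), X (Suc n) \<omega>)) \<in> measurable M (state_space \<Otimes>\<^sub>M borel)"
    by (intro measurable_Pair measurable_rec_num measurable_rec_val measurable_mark) simp
  have mI [measurable]: "?I \<in> borel_measurable state_space"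
    by measurable
  have int: "integrable (?J \<Otimes>\<^sub>M cube_law) (step_value F n)"
  proof (rule P.Fubini_integrable)
    have "integrable M (\<lambda>\<omega>. (1 - exp (- neg_log n \<omega>)) *\<^sub>R ?N (rec_num n \<omega>) (neg_log n \<omega>)
        + exp (- neg_log n \<omega>) *\<^sub>R (\<integral>g. ?N (Suc (rec_num n \<omega>)) (neg_log n \<omega> + g) \<partial>gamma_law CARD('d)))"
    proof (rule Bochner_Integration.integrable_add)
      show "integrable M (\<lambda>\<omega>. (1 - exp (- neg_log n \<omega>)) *\<^sub>R ?N (rec_num n \<omega>) (neg_log n \<omega>))"
      proof (rule Bochner_Integration.integrable_bound[OF F_int])
        show "AE \<omega> in M. norm ((1 - exp (- neg_log n \<omega>)) *\<^sub>R ?N (rec_num n \<omega>) (neg_log n \<omega>)) \<le> norm (F (rec_num n \<omega>) (neg_log n \<omega>))"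
          using AE_neg_log_nonneg
        proof eventually_elim
          case (elim \<omega>)
          then have "0 \<le> 1 - exp (- neg_log n \<omega>)" "1 - exp (- neg_log n \<omega>) \<le> 1"
            by auto
          then show ?case
            by (simp add: mult_left_le_one_le)
        qed
      qed measurable
    qed (use G_int in simp)
    then have "integrable ?J ?I"
      unfolding integrable_distr_eq[OF mKR mI] neg_log_def fst_conv snd_conv .
    \<comment> \<open>By the transition formula applied to the norm of F, \<open>?I\<close> is
      almost everywhere the inner integral over the fresh mark.\<close>
    moreover have "integrable ?J ?I \<longleftrightarrow> integrable ?J (\<lambda>y. \<integral>x. norm (step_value F n (y, x)) \<partial>cube_law)"
    proof (rule integrable_cong_AE)
      show "AE y in ?J. ?I y = (\<integral>x. norm (step_value F n (y, x)) \<partial>cube_law)"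
        using AE_state
      proof eventually_elim
        case (elim y)
        then show ?case
          using has_bochner_integral_step_value[OF mN iN, where r="snd y" and n=n and k="fst y", THEN has_bochner_integral_integral_eq]
          by (simp add: norm_step)
      qed
    qed measurable
    ultimately show "integrable ?J (\<lambda>y. \<integral>x. norm (step_value F n (y, x)) \<partial>cube_law)"
      by simp
    show "AE y in ?J. integrable cube_law (\<lambda>x. step_value F n (y, x))"
      using AE_state
    proof eventually_elim
      case (elim y)
      then show ?case
        using has_bochner_integral_step_value[OF measurable_F integrable_F, where r="snd y" and n=n and k="fst y", THEN integrable.intros]
        by simp
    qed
  qed measurable
  then show ?thesis
    unfolding joint_law[symmetric] integrable_distr_eq[OF mXY mS] step_value_state .
qed

text \<open>The Markov property in integrated form: by the product law, Fubini's theorem lets the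
  fresh mark be integrated out first. All later recursions are instances for a suitable F.\<close>

lemma step_expectation:
  assumes F_int: "integrable M (\<lambda>\<omega>. F (rec_num (Suc n) \<omega>) (neg_log (Suc n) \<omega>))"
  shows "expectation (\<lambda>\<omega>. F (rec_num (Suc n) \<omega>) (neg_log (Suc n) \<omega>))
    = expectation (\<lambda>\<omega>. (1 - exp (- neg_log n \<omega>)) *\<^sub>R F (rec_num n \<omega>) (neg_log n \<omega>)
        + exp (- neg_log n \<omega>) *\<^sub>R (\<integral>g. F (Suc (rec_num n \<omega>)) (neg_log n \<omega> + g) \<partial>gamma_law CARD('d)))"
proof -
  let ?J = "distr M state_space (\<lambda>\<omega>. (rec_num n \<omega>, rec_val n \<omega>))"
  interpret J: prob_space ?J
    by (rule prob_space_distr) measurable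
  interpret C: prob_space "cube_law :: (real ^ 'd) measure"
    by (rule prob_space_cube_law)
  interpret P: pair_sigma_finite ?J "cube_law :: (real ^ 'd) measure" ..
  let ?I = "\<lambda>y. (1 - exp (- neg_log_vol (snd y))) *\<^sub>R F (fst y) (neg_log_vol (snd y))
      + exp (- neg_log_vol (snd y)) *\<^sub>R (\<integral>g. F (Suc (fst y)) (neg_log_vol (snd y) + g) \<partial>gamma_law CARD('d))"
  have mS [measurable]: "step_value F n \<in> borel_measurable (state_space \<Otimes>\<^sub>M borel)"
    by (rule measurable_step_value) measurable
  have [measurable]: "(\<lambda>y. \<integral>g. F (Suc (fst y)) (neg_log_vol (snd y) + g) \<partial>gamma_law CARD('d)) \<in> borel_measurable state_space"
    by (rule measurable_gamma_integral) measurable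
  have mKR [measurable]: "(\<lambda>\<omega>. (rec_num n \<omega>, rec_val n \<omega>)) \<in> measurable M state_space"
    by measurable
  have mXY: "(\<lambda>\<omega>. ((rec_num n \<omega>, rec_val n \<omega>), X (Suc n) \<omega>)) \<in> measurable M (state_space \<Otimes>\<^sub>M borel)"
    by (intro measurable_Pair measurable_rec_num measurable_rec_val measurable_mark) simp
  have mI [measurable]: "?I \<in> borel_measurable state_space"
    by measurable
  have int: "integrable (?J \<Otimes>\<^sub>M cube_law) (step_value F n)"
    unfolding joint_law[symmetric] integrable_distr_eq[OF mXY mS] step_value_state by (rule F_int)
  have "expectation (\<lambda>\<omega>. F (rec_num (Suc n) \<omega>) (neg_log (Suc n) \<omega>)) = integral\<^sup>L (?J \<Otimes>\<^sub>M cube_law) (step_value F n)"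
    unfolding joint_law[symmetric] integral_distr[OF mXY mS] step_value_state ..
  also have "\<dots> = (\<integral>y. (\<integral>x. step_value F n (y, x) \<partial>cube_law) \<partial>?J)"
    using P.integral_fst'[OF int] by simp
  also have "\<dots> = (\<integral>y. ?I y \<partial>?J)"
  proof (rule integral_cong_AE)
    show "AE y in ?J. (\<integral>x. step_value F n (y, x) \<partial>cube_law) = ?I y"
      using AE_state
    proof eventually_elim
      case (elim y)
      then show ?case
        using has_bochner_integral_step_value[OF measurable_F integrable_F, where r="snd y" and n=n and k="fst y", THEN has_bochner_integral_integral_eq]
        by simp
    qed
  qed measurable
  also have "\<dots> = expectation (\<lambda>\<omega>. ?I (rec_num n \<omega>, rec_val n \<omega>))"
    by (rule integral_distr[OF mKR mI])
  finally show ?thesis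
    unfolding neg_log_def fst_conv snd_conv .
qed

end

end

subsection \<open>Concentration of the record volume\<close>

lemma has_bochner_integral_gamma_law_shift:
  fixes s l :: real
  assumes "- 1 < s"
  shows "has_bochner_integral (gamma_law CARD('d::finite)) (\<lambda>g. exp (- s * (l + g))) (exp (- s * l) / (1 + s) ^ CARD('d))"
proof -
  have "has_bochner_integral (gamma_law CARD('d)) (\<lambda>g. exp (- s * l) * exp (- s * g)) (exp (- s * l) * (1 / (1 + s) ^ CARD('d)))"
    by (intro has_bochner_integral_mult_right has_bochner_integral_gamma_law_exp assms)
  then show ?thesis
    by (simp only: exp_add[symmetric] distrib_left times_divide_eq_right mult_1_right)
qed

text \<open>A discrete form of f' = -f^2 / 2. The map x - x^2 / 2 is increasing on the unit
  interval, so the bound b for time n can replace a n, and b - b^2 / 2 is at most the bound for time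
  n + 1.\<close>

lemma decreasing_recursion_bound:
  fixes a :: "nat \<Rightarrow> real"
  assumes a0: "a 0 \<le> 1" and nonneg: "\<And>n. 0 \<le> a n" and rec: "\<And>n. a (Suc n) \<le> a n - (a n)\<^sup>2 / 2"
  shows "a n \<le> 2 / (real n + 2)"
proof (induction n)
  case 0
  then show ?case
    using a0 by simp
next
  case (Suc n)
  define b where "b = 2 / (real n + 2)"
  have b: "b \<le> 1" "0 < b"
    by (auto simp: b_def)
  \<comment> \<open>Monotonicity as a factorisation: both factors are nonnegative because a n \<le>
    b \<le> 1.\<close>
  have "(b - (b\<^sup>2) / 2) - (a n - (a n)\<^sup>2 / 2) = (b - a n) * (1 - (b + a n) / 2)"
    by (simp add: field_simps power2_eq_square)
  also have "\<dots> \<ge> 0"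
    using Suc.IH b unfolding b_def[symmetric] by (intro mult_nonneg_nonneg) auto
  finally have "a (Suc n) \<le> b - b\<^sup>2 / 2"
    using rec[of n] by linarith
  also have "\<dots> \<le> 2 / (real (Suc n) + 2)"
  proof -
    define x where "x = real n + 2"
    have x: "0 < x"
      by (simp add: x_def)
    then have "2 / (x + 1) - (b - b\<^sup>2 / 2) = 2 / (x\<^sup>2 * (x + 1))"
      unfolding b_def x_def[symmetric] by (simp add: field_simps power2_eq_square)
    also have "\<dots> \<ge> 0"
      using x by simp
    finally show ?thesis
      by (simp add: x_def add_ac)
  qed
  finally show ?case .
qed

text \<open>The increments telescope against a square root: 1 / sqrt (n + 2) is at most twice sqrt
  (n + 2) - sqrt (n + 1). Together with sqrt 2 \<le> 3 / 2 this gives the constant 3.\<close>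

lemma increasing_recursion_bound:
  fixes b :: "nat \<Rightarrow> real"
  assumes A: "1 \<le> A" and b0: "b 0 \<le> 1" and rec: "\<And>n. b (Suc n) \<le> b n + A * sqrt (2 / (real n + 2))"
  shows "b n \<le> 3 * A * sqrt (real n + 1)"
proof (induction n)
  case 0
  then show ?case
    using A b0 by simp
next
  case (Suc n)
  have sq: "sqrt (real n + 1) \<le> sqrt (real n + 2)" "0 < sqrt (real n + 2)"
    by auto
  have "(sqrt (real n + 2) - sqrt (real n + 1)) * (sqrt (real n + 2) + sqrt (real n + 1)) = 1"
    by (simp add: algebra_simps)
  moreover have "(sqrt (real n + 2) - sqrt (real n + 1)) * (sqrt (real n + 2) + sqrt (real n + 1))
      \<le> (sqrt (real n + 2) - sqrt (real n + 1)) * (2 * sqrt (real n + 2))"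
    using sq by (intro mult_left_mono) auto
  ultimately have *: "1 / sqrt (real n + 2) \<le> 2 * (sqrt (real n + 2) - sqrt (real n + 1))"
    using sq by (simp add: field_simps)
  have "sqrt 2 \<le> 3 / 2"
    by (rule real_le_lsqrt) (auto simp: power2_eq_square)
  then have "sqrt (2 / (real n + 2)) \<le> 3 / 2 * (1 / sqrt (real n + 2))"
    using divide_right_mono[of "sqrt 2" "3 / 2" "sqrt (real n + 2)"] by (simp add: real_sqrt_divide)
  also have "\<dots> \<le> 3 * (sqrt (real n + 2) - sqrt (real n + 1))"
    using * by simp
  finally have "A * sqrt (2 / (real n + 2)) \<le> A * (3 * (sqrt (real n + 2) - sqrt (real n + 1)))"
    using A by (intro mult_left_mono) auto
  then show ?case
    using rec[of n] Suc.IH by (simp add: algebra_simps)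
qed

text \<open>The quadratic Taylor term of exp at x / 2 is x^2 / 8. With this, a single exponential
  moment controls second moments.\<close>

lemma square_le_exp_half:
  fixes x :: real
  assumes "0 \<le> x"
  shows "x\<^sup>2 \<le> 8 * exp (x / 2)"
  using exp_lower_Taylor_quadratic[of "x / 2"] assms by (simp add: power_divide)

lemma le_exp_half:
  fixes x :: real
  shows "x \<le> 2 * exp (x / 2)"
  using exp_ge_add_one_self[of "x / 2"] by linarith

section \<open>Exponential moments of the negative log volume\<close>

context uniform_marks
begin

lemma rec_num_0 [simp]: "rec_num 0 \<omega> = 0"
  by (simp add: rec_num_def)

lemma neg_log_0 [simp]: "neg_log 0 \<omega> = 0"
  by (simp add: neg_log_def rec_val_def neg_log_vol_def)

lemma integrable_exp_neg_neg_log [simp]: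
  assumes "0 \<le> s"
  shows "integrable M (\<lambda>\<omega>. exp (- s * neg_log n \<omega>))"
proof (rule integrable_const_bound[where B=1])
  show "AE \<omega> in M. norm (exp (- s * neg_log n \<omega>)) \<le> 1"
    using AE_neg_log_nonneg by eventually_elim (use assms in \<open>simp add: mult_nonneg_nonneg\<close>)
qed measurable

text \<open>A record multiplies the mean of exp (L / 2) by 2^d, the Gamma transform at -1/2, but
  occurs only with probability exp (-L). The product 2^d exp (-L / 2) is bounded, so integrability
  passes from n to n + 1.\<close>

lemma integrable_exp_half_neg_log: "integrable M (\<lambda>\<omega>. exp (neg_log n \<omega> / 2))"
proof (induction n)
  case (Suc n)
  have half: "has_bochner_integral (gamma_law CARD('d)) (\<lambda>g. exp ((l + g) / 2)) (exp (l / 2) * 2 ^ CARD('d))" for l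
    using has_bochner_integral_gamma_law_shift[of "- 1 / 2" l, where 'd='d] by (simp add: power_divide)
  show ?case
  proof (rule step_integrable[where F="\<lambda>_ l. exp (l / 2)"])
    show "integrable (gamma_law CARD('d)) (\<lambda>g. exp ((l + g) / 2))" for l
      using half by (rule integrable.intros)
    have "integrable M (\<lambda>\<omega>. 2 ^ CARD('d) * exp (- (1/2) * neg_log n \<omega>))"
      by (intro integrable_mult_right integrable_exp_neg_neg_log) simp
    moreover have "exp (- neg_log n \<omega>) * (\<integral>g. norm (exp ((neg_log n \<omega> + g) / 2)) \<partial>gamma_law CARD('d))
        = 2 ^ CARD('d) * exp (- (1/2) * neg_log n \<omega>)" for \<omega>
      unfolding real_norm_def abs_exp_cancel half[THEN has_bochner_integral_integral_eq]
      by (simp add: mult.assoc[symmetric] exp_add[symmetric])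
    ultimately show "integrable M (\<lambda>\<omega>. exp (- neg_log n \<omega>) * (\<integral>g. norm (exp ((neg_log n \<omega> + g) / 2)) \<partial>gamma_law CARD('d)))"
      by simp
  qed (use Suc in auto)
qed simp

lemma integrable_dominated_exp_half_neg_log:
  fixes f :: "'a \<Rightarrow> 'b :: {banach, second_countable_topology}"
  assumes [measurable]: "f \<in> borel_measurable M"
    and "\<And>\<omega>. 0 \<le> neg_log n \<omega> \<Longrightarrow> norm (f \<omega>) \<le> C * exp (neg_log n \<omega> / 2)"
  shows "integrable M f"
proof (rule Bochner_Integration.integrable_bound[where f="\<lambda>\<omega>. C * exp (neg_log n \<omega> / 2)"])
  show "AE \<omega> in M. norm (f \<omega>) \<le> norm (C * exp (neg_log n \<omega> / 2))"
    using AE_neg_log_nonneg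
  proof eventually_elim
    case (elim \<omega>)
    then show ?case
      using assms(2)[of \<omega>] abs_ge_self[of "C * exp (neg_log n \<omega> / 2)"]
      unfolding real_norm_def by force
  qed
qed (use integrable_exp_half_neg_log in auto)

lemma integrable_neg_log: "integrable M (neg_log n)"
proof (rule integrable_dominated_exp_half_neg_log)
  show "norm (neg_log n \<omega>) \<le> 2 * exp (neg_log n \<omega> / 2)" if "0 \<le> neg_log n \<omega>" for \<omega>
    using le_exp_half[of "neg_log n \<omega>"] that by simp
qed measurable

lemma integrable_L2: "integrable M (\<lambda>\<omega>. (neg_log n \<omega>)\<^sup>2)"
proof (rule integrable_dominated_exp_half_neg_log)
  show "norm ((neg_log n \<omega>)\<^sup>2) \<le> 8 * exp (neg_log n \<omega> / 2)" if "0 \<le> neg_log n \<omega>" for \<omega>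
    using square_le_exp_half[OF that] by simp
qed measurable

lemma measurable_real_rec_num [measurable]: "(\<lambda>\<omega>. real (rec_num n \<omega>)) \<in> borel_measurable M"
  by (rule measurable_compose[OF measurable_rec_num]) simp

lemma integrable_rec_num: "integrable M (\<lambda>\<omega>. real (rec_num n \<omega>))"
  by (rule integrable_const_bound[where B="real n"]) (use rec_num_le in auto)

text \<open>Also the probability that mark n + 1 is a record, since the conditional probability is
  the volume of the box below the current record.\<close>

definition mean_vol :: "nat \<Rightarrow> real" where
  "mean_vol n = expectation (\<lambda>\<omega>. exp (- neg_log n \<omega>))"

lemma exp_neg_neg_log [simp]: "integrable M (\<lambda>\<omega>. exp (- neg_log n \<omega>))" "integrable M (\<lambda>\<omega>. (exp (- neg_log n \<omega>))\<^sup>2)"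
  using integrable_exp_neg_neg_log[of 1 n] integrable_exp_neg_neg_log[of 2 n] by (auto simp: exp_double[symmetric])

lemma power2_expectation_le:
  fixes f :: "'a \<Rightarrow> real"
  assumes "integrable M f" "integrable M (\<lambda>\<omega>. (f \<omega>)\<^sup>2)"
  shows "(expectation f)\<^sup>2 \<le> expectation (\<lambda>\<omega>. (f \<omega>)\<^sup>2)"
  using variance_eq[OF assms] variance_positive[of f] by simp

text \<open>A record multiplies the mean volume by 2^-d and has probability V, so the conditional
  mean becomes V - (1 - 2^-d) V^2. The coefficient is at least 1/2 as d \<ge> 1, and the mean of V^2
  is at least the square of the mean.\<close>

lemma mean_vol_recursion: "mean_vol (Suc n) \<le> mean_vol n - (mean_vol n)\<^sup>2 / 2"
proof -
  have int: "has_bochner_integral (gamma_law CARD('d)) (\<lambda>g. exp (- (l + g))) (exp (- l) / 2 ^ CARD('d))" for l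
    using has_bochner_integral_gamma_law_shift[of 1 l, where 'd='d] by simp
  have "mean_vol (Suc n) = expectation (\<lambda>\<omega>. (1 - exp (- neg_log n \<omega>)) *\<^sub>R exp (- neg_log n \<omega>)
        + exp (- neg_log n \<omega>) *\<^sub>R (exp (- neg_log n \<omega>) / 2 ^ CARD('d)))"
    unfolding mean_vol_def int[THEN has_bochner_integral_integral_eq, symmetric]
    by (rule step_expectation[where F="\<lambda>_ l. exp (- l)"]) (use int in \<open>auto intro: integrable.intros\<close>)
  also have "\<dots> = expectation (\<lambda>\<omega>. exp (- neg_log n \<omega>) - (1 - 1 / 2 ^ CARD('d)) * (exp (- neg_log n \<omega>))\<^sup>2)"
    by (intro Bochner_Integration.integral_cong) (auto simp: algebra_simps power2_eq_square)
  also have "\<dots> = mean_vol n - (1 - 1 / 2 ^ CARD('d)) * expectation (\<lambda>\<omega>. (exp (- neg_log n \<omega>))\<^sup>2)"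
    by (simp add: mean_vol_def)
  also have "\<dots> \<le> mean_vol n - 1 / 2 * (mean_vol n)\<^sup>2"
  proof -
    have "(2::real) ^ 1 \<le> 2 ^ CARD('d)"
      by (rule power_increasing) (auto simp: Suc_le_eq)
    then have "1 / 2 \<le> 1 - 1 / (2::real) ^ CARD('d)"
      by (simp add: field_simps)
    moreover have "(mean_vol n)\<^sup>2 \<le> expectation (\<lambda>\<omega>. (exp (- neg_log n \<omega>))\<^sup>2)"
      unfolding mean_vol_def by (rule power2_expectation_le) auto
    ultimately have "1 / 2 * (mean_vol n)\<^sup>2 \<le> (1 - 1 / 2 ^ CARD('d)) * expectation (\<lambda>\<omega>. (exp (- neg_log n \<omega>))\<^sup>2)"
      by (intro mult_mono) auto
    then show ?thesis
      by simp
  qed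
  finally show ?thesis
    by simp
qed

lemma mean_vol_nonneg: "0 \<le> mean_vol n"
  unfolding mean_vol_def by simp

lemma mean_vol_le: "mean_vol n \<le> 2 / (real n + 2)"
  by (rule decreasing_recursion_bound) (auto simp: mean_vol_recursion mean_vol_nonneg, simp add: mean_vol_def prob_space)

text \<open>One step adds (2^d - 1) E V^(1/2), and the bound on E V makes this increment of order
  n^(-1/2). The resulting growth sqrt n is the right order, since L is close to ln n.\<close>

lemma expectation_exp_half_neg_log: "expectation (\<lambda>\<omega>. exp (neg_log n \<omega> / 2)) \<le> 3 * 2 ^ CARD('d) * sqrt (real n + 1)"
proof (rule increasing_recursion_bound)
  fix n
  have int: "has_bochner_integral (gamma_law CARD('d)) (\<lambda>g. exp ((l + g) / 2)) (exp (l / 2) * 2 ^ CARD('d))" for l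
    using has_bochner_integral_gamma_law_shift[of "- 1 / 2" l, where 'd='d] by (simp add: power_divide)
  have int2: "integrable M (\<lambda>\<omega>. exp (- (neg_log n \<omega> / 2)))"
    using integrable_exp_neg_neg_log[of "1/2" n] by simp
  have "expectation (\<lambda>\<omega>. exp (neg_log (Suc n) \<omega> / 2)) = expectation (\<lambda>\<omega>. (1 - exp (- neg_log n \<omega>)) *\<^sub>R exp (neg_log n \<omega> / 2)
        + exp (- neg_log n \<omega>) *\<^sub>R (exp (neg_log n \<omega> / 2) * 2 ^ CARD('d)))"
    unfolding int[THEN has_bochner_integral_integral_eq, symmetric]
    by (rule step_expectation[where F="\<lambda>_ l. exp (l / 2)"])
       (use int integrable_exp_half_neg_log in \<open>auto intro: integrable.intros\<close>)
  also have "\<dots> = expectation (\<lambda>\<omega>. exp (neg_log n \<omega> / 2) + (2 ^ CARD('d) - 1) * exp (- (neg_log n \<omega> / 2)))"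
  proof (intro Bochner_Integration.integral_cong refl)
    fix \<omega>
    have "exp (- neg_log n \<omega>) * exp (neg_log n \<omega> / 2) = exp (- (neg_log n \<omega> / 2))"
      by (simp add: exp_add[symmetric])
    then show "(1 - exp (- neg_log n \<omega>)) *\<^sub>R exp (neg_log n \<omega> / 2) + exp (- neg_log n \<omega>) *\<^sub>R (exp (neg_log n \<omega> / 2) * 2 ^ CARD('d))
        = exp (neg_log n \<omega> / 2) + (2 ^ CARD('d) - 1) * exp (- (neg_log n \<omega> / 2))"
      by (simp add: algebra_simps)
  qed
  also have "\<dots> = expectation (\<lambda>\<omega>. exp (neg_log n \<omega> / 2)) + (2 ^ CARD('d) - 1) * expectation (\<lambda>\<omega>. exp (- (neg_log n \<omega> / 2)))"
    using int2 integrable_exp_half_neg_log by simp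
  also have "\<dots> \<le> expectation (\<lambda>\<omega>. exp (neg_log n \<omega> / 2)) + 2 ^ CARD('d) * sqrt (2 / (real n + 2))"
  proof -
    \<comment> \<open>Cauchy-Schwarz: the mean of V^(1/2) is at most the root of the mean of
      V.\<close>
    have "(expectation (\<lambda>\<omega>. exp (- (neg_log n \<omega> / 2))))\<^sup>2 \<le> expectation (\<lambda>\<omega>. (exp (- (neg_log n \<omega> / 2)))\<^sup>2)"
      by (rule power2_expectation_le) (use int2 in \<open>auto simp: exp_double[symmetric]\<close>)
    also have "\<dots> = mean_vol n"
      by (simp add: mean_vol_def exp_double[symmetric])
    also have "\<dots> \<le> 2 / (real n + 2)"
      by (rule mean_vol_le)
    finally have "expectation (\<lambda>\<omega>. exp (- (neg_log n \<omega> / 2))) \<le> sqrt (2 / (real n + 2))"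
      by (rule real_le_rsqrt)
    then show ?thesis
      by (intro add_left_mono mult_mono) auto
  qed
  finally show "expectation (\<lambda>\<omega>. exp (neg_log (Suc n) \<omega> / 2))
      \<le> expectation (\<lambda>\<omega>. exp (neg_log n \<omega> / 2)) + 2 ^ CARD('d) * sqrt (2 / (real n + 2))" .
qed (auto simp: prob_space)

end

subsection \<open>Moments of the record count\<close>

text \<open>Division by g turns the absolute error h into the relative error
  \<open>h n / g n\<close>.\<close>

lemma asymp_equiv_of_close:
  fixes f g h :: "nat \<Rightarrow> real"
  assumes close: "eventually (\<lambda>n. \<bar>f n - g n\<bar> \<le> h n) at_top"
    and pos: "eventually (\<lambda>n. 0 < g n) at_top"
    and small: "(\<lambda>n. h n / g n) \<longlonglongrightarrow> 0"
  shows "f \<sim>[at_top] g"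
proof (rule asymp_equivI')
  have "(\<lambda>n. f n / g n - 1) \<longlonglongrightarrow> 0"
  proof (rule Lim_null_comparison[OF _ small])
    show "eventually (\<lambda>n. norm (f n / g n - 1) \<le> h n / g n) at_top"
      using close pos
    proof eventually_elim
      case (elim n)
      then have "norm (f n / g n - 1) = \<bar>f n - g n\<bar> / g n"
        by (simp add: diff_divide_distrib[symmetric] divide_simps)
      with elim show ?case
        by (simp add: divide_right_mono)
    qed
  qed
  then show "(\<lambda>n. f n / g n) \<longlonglongrightarrow> 1"
    by (simp add: LIM_zero_iff)
qed

context uniform_marks
begin

lemma expectation_rec_num_Suc: "expectation (\<lambda>\<omega>. real (rec_num (Suc n) \<omega>)) = expectation (\<lambda>\<omega>. real (rec_num n \<omega>)) + mean_vol n"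
proof -
  interpret G: prob_space "gamma_law CARD('d)"
    by (rule prob_space_gamma_law)
  have int: "has_bochner_integral (gamma_law CARD('d)) (\<lambda>g. c) c" for c :: real
    using has_bochner_integral_integrable[OF G.integrable_const[of c]] G.prob_space by simp
  have int_vK: "integrable M (\<lambda>\<omega>. exp (- neg_log n \<omega>) * real (rec_num n \<omega>))"
  proof (rule integrable_const_bound[where B="real n"])
    show "AE \<omega> in M. norm (exp (- neg_log n \<omega>) * real (rec_num n \<omega>)) \<le> real n"
      using AE_neg_log_nonneg
    proof eventually_elim
      case (elim \<omega>)
      have "exp (- neg_log n \<omega>) * real (rec_num n \<omega>) \<le> 1 * real n"
        using elim rec_num_le[of n \<omega>] by (intro mult_mono) auto
      then show ?case
        by simp
    qed
  qed measurable
  have "expectation (\<lambda>\<omega>. real (rec_num (Suc n) \<omega>)) = expectation (\<lambda>\<omega>. (1 - exp (- neg_log n \<omega>)) *\<^sub>R real (rec_num n \<omega>)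
      + exp (- neg_log n \<omega>) *\<^sub>R (\<integral>g. real (Suc (rec_num n \<omega>)) \<partial>gamma_law CARD('d)))"
    by (rule step_expectation[where F="\<lambda>k l. real k"]) (use int integrable_rec_num in \<open>auto intro: integrable.intros\<close>)
  also have "\<dots> = expectation (\<lambda>\<omega>. real (rec_num n \<omega>) + exp (- neg_log n \<omega>))"
    unfolding int[THEN has_bochner_integral_integral_eq]
    by (intro Bochner_Integration.integral_cong) (auto simp: algebra_simps)
  finally show ?thesis
    using integrable_rec_num by (simp add: mean_vol_def)
qed

lemma expectation_neg_log_Suc: "expectation (neg_log (Suc n)) = expectation (neg_log n) + CARD('d) * mean_vol n"
proof -
  interpret G: prob_space "gamma_law CARD('d)"
    by (rule prob_space_gamma_law)
  have "has_bochner_integral (gamma_law CARD('d)) (\<lambda>g. l + g)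
      ((\<integral>g. l \<partial>gamma_law CARD('d)) + (\<integral>g. g \<partial>gamma_law CARD('d)))" for l :: real
    by (intro has_bochner_integral_add has_bochner_integral_integrable G.integrable_const gamma_law_moments) simp
  then have int: "has_bochner_integral (gamma_law CARD('d)) (\<lambda>g. l + g) (l + CARD('d))" for l
    by (simp only: gamma_law_moments(3)[OF zero_less_card_finite] lebesgue_integral_const G.prob_space scaleR_one)
  have "expectation (neg_log (Suc n)) = expectation (\<lambda>\<omega>. (1 - exp (- neg_log n \<omega>)) *\<^sub>R neg_log n \<omega>
      + exp (- neg_log n \<omega>) *\<^sub>R (\<integral>g. neg_log n \<omega> + g \<partial>gamma_law CARD('d)))"
    by (rule step_expectation[where F="\<lambda>k l. l"]) (use int integrable_neg_log in \<open>auto intro: integrable.intros\<close>)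
  also have "\<dots> = expectation (\<lambda>\<omega>. neg_log n \<omega> + CARD('d) * exp (- neg_log n \<omega>))"
    unfolding int[THEN has_bochner_integral_integral_eq]
    by (intro Bochner_Integration.integral_cong) (auto simp: algebra_simps)
  finally show ?thesis
    using integrable_neg_log by (simp add: mean_vol_def)
qed

text \<open>A record adds 1 to the count and d on average to L, so both means start at 0 and have
  proportional increments. This transfers the mean of L to the count.\<close>

lemma expectation_rec_num: "expectation (\<lambda>\<omega>. real (rec_num n \<omega>)) = expectation (neg_log n) / CARD('d)"
  by (induction n) (auto simp: expectation_rec_num_Suc expectation_neg_log_Suc add_divide_distrib)

text \<open>The mean-zero martingale K - L / d. Since L fluctuates only boundedly around ln n, it
  carries the leading fluctuations of the count.\<close>

definition centred :: "nat \<Rightarrow> 'a \<Rightarrow> real" where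
  "centred n \<omega> = real (rec_num n \<omega>) - neg_log n \<omega> / CARD('d)"

lemma measurable_centred [measurable]: "centred n \<in> borel_measurable M"
  unfolding centred_def[abs_def] by measurable

lemma integrable_W2: "integrable M (\<lambda>\<omega>. (centred n \<omega>)\<^sup>2)"
proof (rule integrable_dominated_exp_half_neg_log)
  fix \<omega>
  assume nonneg: "0 \<le> neg_log n \<omega>"
  have "\<bar>centred n \<omega>\<bar> \<le> real n + neg_log n \<omega>"
  proof -
    have "neg_log n \<omega> / CARD('d) \<le> neg_log n \<omega>"
      using nonneg by (simp add: divide_le_eq mult_le_cancel_left1 Suc_le_eq)
    moreover have "0 \<le> neg_log n \<omega> / CARD('d)"
      using nonneg by simp
    ultimately show ?thesis
      using rec_num_le[of n \<omega>] by (simp add: centred_def abs_le_iff)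
  qed
  then have "(centred n \<omega>)\<^sup>2 \<le> (real n + neg_log n \<omega>)\<^sup>2"
    by (rule abs_le_square_iff[THEN iffD1, OF order.trans]) (use nonneg in simp)
  also have "\<dots> \<le> 2 * (real n)\<^sup>2 + 2 * (neg_log n \<omega>)\<^sup>2"
    using sum_squares_ge_zero[of "real n - neg_log n \<omega>" 0] by (simp add: power2_eq_square algebra_simps)
  also have "\<dots> \<le> 2 * (real n)\<^sup>2 * exp (neg_log n \<omega> / 2) + 16 * exp (neg_log n \<omega> / 2)"
    using square_le_exp_half[OF nonneg] nonneg
      mult_left_mono[of 1 "exp (neg_log n \<omega> / 2)" "2 * (real n)\<^sup>2"] by simp
  finally show "norm ((centred n \<omega>)\<^sup>2) \<le> (2 * (real n)\<^sup>2 + 16) * exp (neg_log n \<omega> / 2)"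
    by (simp add: algebra_simps)
qed measurable

text \<open>A record changes the martingale by 1 - g / d, which has mean 0 and variance 1 / d. Hence
  the second moment grows by \<open>mean_vol n / CARD('d)\<close>, while the mean count grows by
  \<open>mean_vol n\<close>.\<close>

lemma expectation_W2: "expectation (\<lambda>\<omega>. (centred n \<omega>)\<^sup>2) = expectation (\<lambda>\<omega>. real (rec_num n \<omega>)) / CARD('d)"
proof (induction n)
  case (Suc n)
  interpret G: prob_space "gamma_law CARD('d)"
    by (rule prob_space_gamma_law)
  let ?F = "\<lambda>k l. (real k - l / CARD('d))\<^sup>2"
  note mom = gamma_law_moments[OF zero_less_card_finite[where 'a='d]]
  have int: "has_bochner_integral (gamma_law CARD('d)) (\<lambda>g. ?F (Suc k) (l + g)) (?F k l + 1 / CARD('d))" for k l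
  proof -
    \<comment> \<open>The value before the Gamma increment is subtracted: the integrand is (m - g /
      d)^2, whose mean m^2 - 2 m + 1 + 1 / d is (m - 1)^2 + 1 / d.\<close>
    let ?m = "real k - l / CARD('d) + 1"
    have c: "has_bochner_integral (gamma_law CARD('d)) (\<lambda>g. c) c" for c :: real
      using has_bochner_integral_integrable[OF G.integrable_const[of c]] G.prob_space by simp
    have m1: "has_bochner_integral (gamma_law CARD('d)) (\<lambda>g. g) (real CARD('d))"
      and m2: "has_bochner_integral (gamma_law CARD('d)) (\<lambda>g. g\<^sup>2) (real CARD('d) * (real CARD('d) + 1))"
      using mom by (simp_all only: has_bochner_integral_iff simp_thms)
    have "has_bochner_integral (gamma_law CARD('d)) (\<lambda>g. ?m\<^sup>2 - (2 * ?m / CARD('d)) * g + (1 / (CARD('d))\<^sup>2) * g\<^sup>2)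
       (?m\<^sup>2 - (2 * ?m / CARD('d)) * CARD('d) + (1 / (CARD('d))\<^sup>2) * (CARD('d) * (real CARD('d) + 1)))"
      by (intro has_bochner_integral_add has_bochner_integral_diff has_bochner_integral_mult_right c m1 m2)
    also have "(\<lambda>g. ?m\<^sup>2 - (2 * ?m / CARD('d)) * g + (1 / (CARD('d))\<^sup>2) * g\<^sup>2) = (\<lambda>g. ?F (Suc k) (l + g))"
      by (auto simp: fun_eq_iff power2_eq_square field_simps)
    also have "?m\<^sup>2 - (2 * ?m / CARD('d)) * CARD('d) + (1 / (CARD('d))\<^sup>2) * (CARD('d) * (real CARD('d) + 1))
        = ?F k l + 1 / CARD('d)"
      by (simp add: power2_eq_square field_simps)
    finally show ?thesis .
  qed
  \<comment> \<open>The previous fact only covers counts of the form \<open>Suc k\<close>. Raising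
    the count by 1 and l by d leaves the function unchanged, so every k is reached.\<close>
  have int0: "integrable (gamma_law CARD('d)) (\<lambda>g. ?F k (l + g))" for k l
  proof -
    have "integrable (gamma_law CARD('d)) (\<lambda>g. ?F (Suc k) ((l + CARD('d)) + g))"
      using int by (rule integrable.intros)
    also have "(\<lambda>g. ?F (Suc k) ((l + CARD('d)) + g)) = (\<lambda>g. ?F k (l + g))"
    proof
      fix g
      have "real (Suc k) - (l + CARD('d) + g) / CARD('d) = real k - (l + g) / CARD('d)"
        by (simp add: add_divide_distrib)
      then show "?F (Suc k) ((l + CARD('d)) + g) = ?F k (l + g)"
        by (simp only:)
    qed
    finally show ?thesis .
  qed
  have "expectation (\<lambda>\<omega>. ?F (rec_num (Suc n) \<omega>) (neg_log (Suc n) \<omega>)) = expectation (\<lambda>\<omega>. (1 - exp (- neg_log n \<omega>)) *\<^sub>R ?F (rec_num n \<omega>) (neg_log n \<omega>)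
      + exp (- neg_log n \<omega>) *\<^sub>R (\<integral>g. ?F (Suc (rec_num n \<omega>)) (neg_log n \<omega> + g) \<partial>gamma_law CARD('d)))"
    by (rule step_expectation[where F="?F"]) (use int0 integrable_W2 in \<open>simp_all add: centred_def\<close>)
  also have "\<dots> = expectation (\<lambda>\<omega>. ?F (rec_num n \<omega>) (neg_log n \<omega>) + exp (- neg_log n \<omega>) / CARD('d))"
    unfolding int[THEN has_bochner_integral_integral_eq]
    by (intro Bochner_Integration.integral_cong) (auto simp: algebra_simps)
  also have "\<dots> = expectation (\<lambda>\<omega>. ?F (rec_num n \<omega>) (neg_log n \<omega>)) + mean_vol n / CARD('d)"
    using integrable_W2[of n] by (simp add: mean_vol_def centred_def)
  finally show ?case
    using Suc.IH by (simp add: centred_def expectation_rec_num_Suc add_divide_distrib)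
qed (simp add: centred_def)

section \<open>Deviation of the negative log volume from its centre ln n\<close>

definition dev_bound :: real where
  "dev_bound = 6 * 2 ^ CARD('d) + 3"

lemma dev_bound_pos: "0 < dev_bound"
  by (simp add: dev_bound_def add_pos_pos)

text \<open>With y = L - ln n, the upper side is exp (y / 2) = exp (L / 2) / sqrt n, and the lower
  side satisfies exp (-y / 2) \<le> 1 + exp (-y) = 1 + n V. Their means contribute 6 * 2^d, 1 and 2,
  the parts of \<open>dev_bound\<close>.\<close>

lemma exp_deviation:
  assumes "1 \<le> n"
  shows "integrable M (\<lambda>\<omega>. exp (\<bar>neg_log n \<omega> - ln n\<bar> / 2))"
    and "expectation (\<lambda>\<omega>. exp (\<bar>neg_log n \<omega> - ln n\<bar> / 2)) \<le> dev_bound"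
proof -
  let ?B = "\<lambda>\<omega>. exp (neg_log n \<omega> / 2) / sqrt n + 1 + n * exp (- neg_log n \<omega>)"
  have n: "0 < real n"
    using assms by simp
  have le: "exp (\<bar>neg_log n \<omega> - ln n\<bar> / 2) \<le> ?B \<omega>" for \<omega>
  proof -
    have s: "exp (ln (real n) / 2) = sqrt n"
      using n by (simp add: ln_sqrt[symmetric])
    have 1: "exp ((neg_log n \<omega> - ln n) / 2) = exp (neg_log n \<omega> / 2) / sqrt n"
      by (simp add: diff_divide_distrib exp_diff s)
    have 2: "exp (- (neg_log n \<omega> - ln n)) = n * exp (- neg_log n \<omega>)"
      using n by (simp add: exp_diff exp_minus field_simps)
    have "exp (- (neg_log n \<omega> - ln n) / 2) \<le> 1 + exp (- (neg_log n \<omega> - ln n))"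
    proof (cases "- (neg_log n \<omega> - ln n) \<le> 0")
      case True
      then have "exp (- (neg_log n \<omega> - ln n) / 2) \<le> 1"
        by simp
      then show ?thesis
        by (rule order.trans) simp
    next
      case False
      then have "exp (- (neg_log n \<omega> - ln n) / 2) \<le> exp (- (neg_log n \<omega> - ln n))"
        by simp
      then show ?thesis
        by linarith
    qed
    moreover have "0 \<le> exp (neg_log n \<omega> / 2) / sqrt n" "0 \<le> n * exp (- neg_log n \<omega>)"
      using n by auto
    ultimately have "exp ((neg_log n \<omega> - ln n) / 2) \<le> ?B \<omega>" "exp (- (neg_log n \<omega> - ln n) / 2) \<le> ?B \<omega>"
      using 1 2 by linarith+
    moreover have "\<bar>neg_log n \<omega> - ln n\<bar> = neg_log n \<omega> - ln n \<or> \<bar>neg_log n \<omega> - ln n\<bar> = - (neg_log n \<omega> - ln n)"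
      by linarith
    ultimately show ?thesis
      by (elim disjE) (simp_all only:)
  qed
  have intB: "integrable M ?B"
    using integrable_exp_half_neg_log by (intro Bochner_Integration.integrable_add) auto
  show int: "integrable M (\<lambda>\<omega>. exp (\<bar>neg_log n \<omega> - ln n\<bar> / 2))"
    by (rule Bochner_Integration.integrable_bound[OF intB]) (measurable, use le in \<open>auto intro!: AE_I2 intro: order.trans\<close>)
  have "expectation (\<lambda>\<omega>. exp (\<bar>neg_log n \<omega> - ln n\<bar> / 2)) \<le> expectation ?B"
    by (intro integral_mono int intB le)
  also have "\<dots> = expectation (\<lambda>\<omega>. exp (neg_log n \<omega> / 2)) / sqrt n + 1 + n * mean_vol n"
    using integrable_exp_half_neg_log by (simp add: mean_vol_def prob_space)
  also have "\<dots> \<le> 6 * 2 ^ CARD('d) + 1 + 2"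
  proof (intro add_mono order.refl)
    \<comment> \<open>Doubling the constant 3 of \<open>expectation_exp_half_neg_log\<close> trades
      n + 1 for n, which is possible since n \<ge> 1.\<close>
    have "sqrt (real n + 1) \<le> sqrt (4 * real n)"
      using assms by (intro real_sqrt_le_mono) simp
    then have "sqrt (real n + 1) \<le> 2 * sqrt n"
      by (simp add: real_sqrt_mult)
    then have "3 * 2 ^ CARD('d) * sqrt (real n + 1) \<le> 3 * 2 ^ CARD('d) * (2 * sqrt n)"
      by (intro mult_left_mono) auto
    with expectation_exp_half_neg_log[of n] have "expectation (\<lambda>\<omega>. exp (neg_log n \<omega> / 2)) \<le> 6 * 2 ^ CARD('d) * sqrt n"
      by linarith
    then show "expectation (\<lambda>\<omega>. exp (neg_log n \<omega> / 2)) / sqrt n \<le> 6 * 2 ^ CARD('d)"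
      using n by (simp add: pos_divide_le_eq)
    have "n * mean_vol n \<le> n * (2 / (real n + 2))"
      by (intro mult_left_mono mean_vol_le) auto
    also have "\<dots> \<le> 2"
      by (simp add: field_simps)
    finally show "n * mean_vol n \<le> 2" .
  qed
  finally show "expectation (\<lambda>\<omega>. exp (\<bar>neg_log n \<omega> - ln n\<bar> / 2)) \<le> dev_bound"
    by (simp add: dev_bound_def)
qed

text \<open>The bounds x \<le> 2 exp (x / 2) and x^2 \<le> 8 exp (x / 2) are applied to x = |L - ln
  n|; the second moment about the mean is at most the one about ln n.\<close>

lemma deviation_moments:
  assumes "1 \<le> n"
  shows "\<bar>expectation (neg_log n) - ln n\<bar> \<le> 2 * dev_bound"
    and "integrable M (\<lambda>\<omega>. (neg_log n \<omega> - expectation (neg_log n))\<^sup>2)"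
    and "expectation (\<lambda>\<omega>. (neg_log n \<omega> - expectation (neg_log n))\<^sup>2) \<le> 8 * dev_bound"
proof -
  let ?D = "\<lambda>\<omega>. neg_log n \<omega> - ln n" and ?E = "\<lambda>\<omega>. exp (\<bar>neg_log n \<omega> - ln n\<bar> / 2)"
  have iD: "integrable M ?D"
    using integrable_neg_log by simp
  have iD2: "integrable M (\<lambda>\<omega>. (?D \<omega>)\<^sup>2)"
    by (simp add: power2_diff integrable_neg_log integrable_L2)
  have ED: "expectation ?D = expectation (neg_log n) - ln n"
    using integrable_neg_log by (simp add: prob_space)
  have "\<bar>expectation ?D\<bar> \<le> expectation (\<lambda>\<omega>. \<bar>?D \<omega>\<bar>)"
    by (rule integral_abs_bound)
  also have "\<dots> \<le> expectation (\<lambda>\<omega>. 2 * ?E \<omega>)"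
    using iD exp_deviation[OF assms] le_exp_half by (intro integral_mono) auto
  also have "\<dots> \<le> 2 * dev_bound"
    using exp_deviation[OF assms] by simp
  finally show "\<bar>expectation (neg_log n) - ln n\<bar> \<le> 2 * dev_bound"
    unfolding ED .
  have eq: "(neg_log n \<omega> - expectation (neg_log n))\<^sup>2 = (?D \<omega>)\<^sup>2 - 2 * expectation ?D * ?D \<omega> + (expectation ?D)\<^sup>2" for \<omega>
    unfolding ED by (simp add: power2_eq_square algebra_simps)
  show "integrable M (\<lambda>\<omega>. (neg_log n \<omega> - expectation (neg_log n))\<^sup>2)"
    unfolding eq using iD iD2 by simp
  have "expectation (\<lambda>\<omega>. (neg_log n \<omega> - expectation (neg_log n))\<^sup>2)
      = expectation (\<lambda>\<omega>. (?D \<omega>)\<^sup>2) - 2 * expectation ?D * expectation ?D + (expectation ?D)\<^sup>2"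
    unfolding eq using iD iD2 by (simp add: prob_space)
  also have "\<dots> \<le> expectation (\<lambda>\<omega>. (?D \<omega>)\<^sup>2)"
    by (simp add: power2_eq_square)
  also have "\<dots> \<le> expectation (\<lambda>\<omega>. 8 * ?E \<omega>)"
    using iD2 exp_deviation[OF assms] square_le_exp_half[of "\<bar>?D \<omega>\<bar>" for \<omega>] by (intro integral_mono) auto
  also have "\<dots> \<le> 8 * dev_bound"
    using exp_deviation[OF assms] by simp
  finally show "expectation (\<lambda>\<omega>. (neg_log n \<omega> - expectation (neg_log n))\<^sup>2) \<le> 8 * dev_bound" .
qed

lemma card_ge_1: "1 \<le> real CARD('d)"
  by (simp add: Suc_le_eq)

lemma divide_card_le: "0 \<le> x \<Longrightarrow> x / real CARD('d) \<le> x"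
  using card_ge_1 by (simp add: divide_le_eq mult_le_cancel_left1)

lemma expectation_rec_num_close:
  assumes "1 \<le> n"
  shows "\<bar>expectation (\<lambda>\<omega>. real (rec_num n \<omega>)) - 1 / CARD('d) * ln n\<bar> \<le> 2 * dev_bound"
proof -
  have "\<bar>expectation (\<lambda>\<omega>. real (rec_num n \<omega>)) - 1 / CARD('d) * ln n\<bar> = \<bar>expectation (neg_log n) - ln n\<bar> / CARD('d)"
    by (simp add: expectation_rec_num diff_divide_distrib[symmetric])
  also have "\<dots> \<le> \<bar>expectation (neg_log n) - ln n\<bar>"
    by (rule divide_card_le) simp
  finally show ?thesis
    using deviation_moments(1)[OF assms] by linarith
qed

text \<open>The deviation K - E K is the martingale plus (L - E L) / d. The second part is bounded
  in mean square, and the cross term is split by a weighted inequality, so the total error is of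
  order sqrt (ln n).\<close>

lemma variance_rec_num_close:
  assumes "2 \<le> n"
  shows "\<bar>variance (\<lambda>\<omega>. real (rec_num n \<omega>)) - 1 / (real CARD('d))\<^sup>2 * ln n\<bar>
    \<le> 2 * dev_bound + ((ln n + 2 * dev_bound) / sqrt (ln n) + (sqrt (ln n) + 1) * (8 * dev_bound))"
proof -
  \<comment> \<open>This weight balances the two error terms: e times a second moment of order ln n,
    and 1 / e times a bounded one, are both of order sqrt (ln n).\<close>
  define e where "e = 1 / sqrt (ln n)"
  define q where "q \<omega> = neg_log n \<omega> - expectation (neg_log n)" for \<omega>
  let ?d = "real CARD('d)"
  have lnn: "0 < ln (real n)"
    using assms by simp
  then have e: "0 < e"
    by (simp add: e_def)
  have n: "1 \<le> n"
    using assms by simp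
  have q_int: "integrable M (\<lambda>\<omega>. (q \<omega>)\<^sup>2)" and q_le: "expectation (\<lambda>\<omega>. (q \<omega>)\<^sup>2) \<le> 8 * dev_bound"
    using deviation_moments[OF n] by (auto simp: q_def)
  have rec_num_int: "integrable M (\<lambda>\<omega>. (real (rec_num n \<omega>) - expectation (\<lambda>\<omega>. real (rec_num n \<omega>)))\<^sup>2)"
  proof -
    have "integrable M (\<lambda>\<omega>. (real (rec_num n \<omega>))\<^sup>2)"
      by (rule integrable_const_bound[where B="(real n)\<^sup>2"]) (use rec_num_le in \<open>auto intro!: power_mono\<close>)
    then show ?thesis
      using integrable_rec_num by (simp add: power2_diff)
  qed
  have pointwise: "\<bar>(real (rec_num n \<omega>) - expectation (\<lambda>\<omega>. real (rec_num n \<omega>)))\<^sup>2 - (centred n \<omega>)\<^sup>2\<bar>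
      \<le> e * (centred n \<omega>)\<^sup>2 + (1 / e + 1) * (q \<omega>)\<^sup>2" for \<omega>
  proof -
    define p where "p = q \<omega> / ?d"
    have "real (rec_num n \<omega>) - expectation (\<lambda>\<omega>. real (rec_num n \<omega>)) = centred n \<omega> + p"
      by (simp add: centred_def p_def q_def expectation_rec_num diff_divide_distrib)
    then have eq: "(real (rec_num n \<omega>) - expectation (\<lambda>\<omega>. real (rec_num n \<omega>)))\<^sup>2 - (centred n \<omega>)\<^sup>2 = 2 * centred n \<omega> * p + p\<^sup>2"
      by (simp add: power2_eq_square algebra_simps)
    \<comment> \<open>Expanding the squares gives 2 |W p| \<le> e W^2 + p^2 / e with W =
      \<open>centred n\<close>.\<close>
    have "0 \<le> (e * centred n \<omega> - p)\<^sup>2 / e" "0 \<le> (e * centred n \<omega> + p)\<^sup>2 / e"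
      using e by auto
    then have "2 * centred n \<omega> * p \<le> e * (centred n \<omega>)\<^sup>2 + p\<^sup>2 / e" "- (2 * centred n \<omega> * p) \<le> e * (centred n \<omega>)\<^sup>2 + p\<^sup>2 / e"
      using e by (simp_all add: power2_eq_square field_simps)
    moreover have "p\<^sup>2 \<le> (q \<omega>)\<^sup>2"
      using divide_card_le[of "\<bar>q \<omega>\<bar>"] by (simp add: p_def abs_le_square_iff[symmetric])
    then have "p\<^sup>2 / e \<le> (1 / e) * (q \<omega>)\<^sup>2" "p\<^sup>2 \<le> (q \<omega>)\<^sup>2"
      using e by (simp_all add: divide_right_mono)
    moreover have "0 \<le> p\<^sup>2" "0 \<le> p\<^sup>2 / e"
      using e by simp_all
    ultimately show ?thesis
      unfolding eq abs_le_iff distrib_right by linarith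
  qed
  have "\<bar>variance (\<lambda>\<omega>. real (rec_num n \<omega>)) - expectation (\<lambda>\<omega>. (centred n \<omega>)\<^sup>2)\<bar>
      = \<bar>expectation (\<lambda>\<omega>. (real (rec_num n \<omega>) - expectation (\<lambda>\<omega>. real (rec_num n \<omega>)))\<^sup>2 - (centred n \<omega>)\<^sup>2)\<bar>"
    using rec_num_int integrable_W2 by simp
  also have "\<dots> \<le> expectation (\<lambda>\<omega>. \<bar>(real (rec_num n \<omega>) - expectation (\<lambda>\<omega>. real (rec_num n \<omega>)))\<^sup>2 - (centred n \<omega>)\<^sup>2\<bar>)"
    by (rule integral_abs_bound)
  also have "\<dots> \<le> expectation (\<lambda>\<omega>. e * (centred n \<omega>)\<^sup>2 + (1 / e + 1) * (q \<omega>)\<^sup>2)"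
    using rec_num_int integrable_W2 q_int
    by (intro integral_mono pointwise integrable_abs Bochner_Integration.integrable_diff
        Bochner_Integration.integrable_add integrable_mult_right)
  also have "\<dots> = e * expectation (\<lambda>\<omega>. (centred n \<omega>)\<^sup>2) + (1 / e + 1) * expectation (\<lambda>\<omega>. (q \<omega>)\<^sup>2)"
    using integrable_W2 q_int by simp
  also have "\<dots> \<le> e * (ln n + 2 * dev_bound) + (1 / e + 1) * (8 * dev_bound)"
  proof (intro add_mono mult_left_mono q_le)
    have "expectation (\<lambda>\<omega>. real (rec_num n \<omega>)) \<le> 1 / ?d * ln n + 2 * dev_bound"
      using expectation_rec_num_close[OF n] by linarith
    also have "\<dots> \<le> ln n + 2 * dev_bound"
      using divide_card_le[of "ln n"] lnn by simp
    finally show "expectation (\<lambda>\<omega>. (centred n \<omega>)\<^sup>2) \<le> ln n + 2 * dev_bound"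
      unfolding expectation_W2
      using divide_card_le[of "expectation (\<lambda>\<omega>. real (rec_num n \<omega>))"] by (simp add: order.trans)
  qed (use e in auto)
  finally have 1: "\<bar>variance (\<lambda>\<omega>. real (rec_num n \<omega>)) - expectation (\<lambda>\<omega>. (centred n \<omega>)\<^sup>2)\<bar>
      \<le> (ln n + 2 * dev_bound) / sqrt (ln n) + (sqrt (ln n) + 1) * (8 * dev_bound)"
    by (simp add: e_def)
  have "\<bar>expectation (\<lambda>\<omega>. (centred n \<omega>)\<^sup>2) - 1 / ?d\<^sup>2 * ln n\<bar> = \<bar>expectation (\<lambda>\<omega>. real (rec_num n \<omega>)) - 1 / ?d * ln n\<bar> / ?d"
  proof -
    have "x / ?d - 1 / ?d\<^sup>2 * y = (x - 1 / ?d * y) / ?d" for x y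
      by (simp add: field_simps power2_eq_square)
    then show ?thesis
      unfolding expectation_W2 by (simp only: abs_divide abs_of_nat)
  qed
  also have "\<dots> \<le> 2 * dev_bound"
    using divide_card_le[of "\<bar>expectation (\<lambda>\<omega>. real (rec_num n \<omega>)) - 1 / ?d * ln n\<bar>"] expectation_rec_num_close[OF n] by linarith
  finally show ?thesis
    using 1 by linarith
qed

lemma expectation_asymp: "(\<lambda>n. expectation (\<lambda>\<omega>. real (rec_num n \<omega>))) \<sim>[at_top] (\<lambda>n. 1 / real CARD('d) * ln (real n))"
proof (rule asymp_equiv_of_close)
  show "eventually (\<lambda>n. \<bar>expectation (\<lambda>\<omega>. real (rec_num n \<omega>)) - 1 / real CARD('d) * ln (real n)\<bar> \<le> 2 * dev_bound) at_top"
    using eventually_ge_at_top[of 1] by eventually_elim (rule expectation_rec_num_close)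
  show "eventually (\<lambda>n. 0 < 1 / real CARD('d) * ln (real n)) at_top"
    using eventually_ge_at_top[of 2] by eventually_elim simp
  have "(\<lambda>n. 2 * dev_bound * (CARD('d)) / ln (real n)) \<longlonglongrightarrow> 0"
    by real_asymp
  then show "(\<lambda>n. 2 * dev_bound / (1 / real CARD('d) * ln (real n))) \<longlonglongrightarrow> 0"
    by simp
qed

lemma variance_asymp: "(\<lambda>n. variance (\<lambda>\<omega>. real (rec_num n \<omega>))) \<sim>[at_top] (\<lambda>n. 1 / (real CARD('d))\<^sup>2 * ln (real n))"
proof (rule asymp_equiv_of_close)
  show "eventually (\<lambda>n. \<bar>variance (\<lambda>\<omega>. real (rec_num n \<omega>)) - 1 / (real CARD('d))\<^sup>2 * ln (real n)\<bar>
      \<le> 2 * dev_bound + ((ln n + 2 * dev_bound) / sqrt (ln n) + (sqrt (ln n) + 1) * (8 * dev_bound))) at_top"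
    using eventually_ge_at_top[of 2] by eventually_elim (rule variance_rec_num_close)
  show "eventually (\<lambda>n. 0 < 1 / (real CARD('d))\<^sup>2 * ln (real n)) at_top"
    using eventually_ge_at_top[of 2] by eventually_elim simp
  have "(\<lambda>n. (2 * dev_bound + ((ln (real n) + 2 * dev_bound) / sqrt (ln n) + (sqrt (ln n) + 1) * (8 * dev_bound))) / ln n) \<longlonglongrightarrow> 0"
    using dev_bound_pos by real_asymp
  from tendsto_mult_left[OF this, of "(real CARD('d))\<^sup>2"]
  show "(\<lambda>n. (2 * dev_bound + ((ln (real n) + 2 * dev_bound) / sqrt (ln n) + (sqrt (ln n) + 1) * (8 * dev_bound)))
      / (1 / (real CARD('d))\<^sup>2 * ln (real n))) \<longlonglongrightarrow> 0"
    by (simp add: mult.commute)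
qed

end

subsection \<open>Asymptotic normality\<close>

lemma norm_iexp_minus_one_le: "cmod (iexp x - 1) \<le> \<bar>x\<bar>"
  using iexp_approx1[of x 0] by simp

lemma norm_exp_minus_one_le:
  fixes z :: complex
  shows "cmod (exp z - 1) \<le> exp (cmod z) * cmod z"
proof -
  have "cmod (exp z - 1) \<le> exp \<bar>Re z\<bar> * cmod z"
    using Taylor_exp[of z 0] by simp
  also have "\<dots> \<le> exp (cmod z) * cmod z"
    by (intro mult_right_mono) (auto simp: abs_Re_le_cmod)
  finally show ?thesis .
qed

context uniform_marks
begin

text \<open>A record multiplies the first factor by exp (i t d) and the mean of exp (-s L) by (1 +
  s)^-d; as 1 + s = exp (i t), these cancel. The bound on t gives Re s \<ge> -1/4, so the Gamma
  transform exists and the modulus is at most exp (L / 2).\<close>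

lemma complex_martingale:
  fixes t :: real
  assumes t: "\<bar>t\<bar> \<le> 1 / 4"
  defines "s \<equiv> iexp t - 1"
  shows "integrable M (\<lambda>\<omega>. exp (\<i> * t * CARD('d) * of_nat (rec_num n \<omega>) - s * of_real (neg_log n \<omega>)))"
    and "expectation (\<lambda>\<omega>. exp (\<i> * t * CARD('d) * of_nat (rec_num n \<omega>) - s * of_real (neg_log n \<omega>))) = 1"
proof -
  define F where "F = (\<lambda>k l. exp (\<i> * t * CARD('d) * of_nat k - s * complex_of_real l))"
  have "\<bar>Re s\<bar> \<le> \<bar>t\<bar>"
    using abs_Re_le_cmod[of s] norm_iexp_minus_one_le[of t] unfolding s_def by linarith
  then have Re_s: "- 1 / 4 \<le> Re s"
    using t by linarith
  have [measurable]: "F k \<in> borel_measurable borel" for k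
    unfolding F_def by measurable
  have mK: "(\<lambda>\<omega>. complex_of_nat (rec_num m \<omega>)) \<in> borel_measurable M" for m
    by (rule measurable_compose[OF measurable_rec_num]) simp
  have int: "integrable M (\<lambda>\<omega>. F (rec_num m \<omega>) (neg_log m \<omega>))" for m
  proof (rule integrable_dominated_exp_half_neg_log)
    show "norm (F (rec_num m \<omega>) (neg_log m \<omega>)) \<le> 1 * exp (neg_log m \<omega> / 2)" if "0 \<le> neg_log m \<omega>" for \<omega>
      using mult_right_mono[OF Re_s that] that by (simp add: F_def)
  qed (use mK in \<open>simp add: F_def\<close>)
  have one_s: "(1 + s) ^ CARD('d) = exp (\<i> * t * CARD('d))"
    by (simp add: s_def exp_of_nat_mult[symmetric] mult.commute mult.left_commute)
  have gamma: "has_bochner_integral (gamma_law CARD('d)) (\<lambda>g. F k (l + g)) (F k l / (1 + s) ^ CARD('d))" for k l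
  proof -
    have "has_bochner_integral (gamma_law CARD('d)) (\<lambda>g. F k l * exp (- s * of_real g)) (F k l * (1 / (1 + s) ^ CARD('d)))"
      by (intro has_bochner_integral_mult_right has_bochner_integral_gamma_law_cexp) (use Re_s in auto)
    also have "(\<lambda>g. F k l * exp (- s * of_real g)) = (\<lambda>g. F k (l + g))"
      by (simp add: F_def exp_add[symmetric] algebra_simps)
    finally show ?thesis
      by (simp only: times_divide_eq_right mult_1_right)
  qed
  have F_Suc: "F (Suc k) l / (1 + s) ^ CARD('d) = F k l" for k l
    unfolding one_s F_def by (simp add: exp_diff[symmetric] algebra_simps)
  show "integrable M (\<lambda>\<omega>. exp (\<i> * t * CARD('d) * of_nat (rec_num n \<omega>) - s * of_real (neg_log n \<omega>)))"
    using int[of n] by (simp only: F_def)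
  have "expectation (\<lambda>\<omega>. F (rec_num n \<omega>) (neg_log n \<omega>)) = 1"
  proof (induction n)
    case 0
    then show ?case
      by (simp add: F_def prob_space)
  next
    case (Suc n)
    have "expectation (\<lambda>\<omega>. F (rec_num (Suc n) \<omega>) (neg_log (Suc n) \<omega>)) = expectation (\<lambda>\<omega>. (1 - exp (- neg_log n \<omega>)) *\<^sub>R F (rec_num n \<omega>) (neg_log n \<omega>)
        + exp (- neg_log n \<omega>) *\<^sub>R (\<integral>g. F (Suc (rec_num n \<omega>)) (neg_log n \<omega> + g) \<partial>gamma_law CARD('d)))"
      by (rule step_expectation[where F=F, OF _ _ int]) (use gamma in \<open>auto intro: integrable.intros\<close>)
    also have "\<dots> = expectation (\<lambda>\<omega>. F (rec_num n \<omega>) (neg_log n \<omega>))"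
      unfolding gamma[THEN has_bochner_integral_integral_eq] F_Suc
      by (intro Bochner_Integration.integral_cong) (auto simp: scaleR_add_left[symmetric])
    finally show ?case
      using Suc.IH by simp
  qed
  then show "expectation (\<lambda>\<omega>. exp (\<i> * t * CARD('d) * of_nat (rec_num n \<omega>) - s * of_real (neg_log n \<omega>))) = 1"
    by (simp only: F_def)
qed

text \<open>Multiplying the martingale identity by n^s yields that exp (i t d K) exp (-s (L - ln n))
  has mean n^s. Since |s| \<le> |t|, dropping the second factor costs at most |t| times an
  exponential moment of |L - ln n|.\<close>

lemma char_rec_num_close:
  fixes t :: real
  assumes t: "\<bar>t\<bar> \<le> 1 / 4" and n: "1 \<le> n"
  shows "cmod (expectation (\<lambda>\<omega>. exp (\<i> * t * CARD('d) * of_nat (rec_num n \<omega>))) - exp ((iexp t - 1) * ln (real n))) \<le> 4 * dev_bound * \<bar>t\<bar>"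
proof -
  define s where "s = iexp t - 1"
  let ?e = "\<lambda>\<omega>. exp (\<i> * t * CARD('d) * of_nat (rec_num n \<omega>))"
  let ?D = "\<lambda>\<omega>. neg_log n \<omega> - ln (real n)"
  have mK [measurable]: "(\<lambda>\<omega>. complex_of_nat (rec_num n \<omega>)) \<in> borel_measurable M"
    by (rule measurable_compose[OF measurable_rec_num]) simp
  have norm_e: "cmod (?e \<omega>) = 1" for \<omega>
    by simp
  have int_e: "integrable M ?e"
    by (rule integrable_const_bound[where B=1]) (simp, measurable)
  note mart = complex_martingale[OF t, of n, folded s_def]
  have eq: "exp (s * ln (real n)) * exp (\<i> * t * CARD('d) * of_nat (rec_num n \<omega>) - s * of_real (neg_log n \<omega>)) = ?e \<omega> * exp (- s * ?D \<omega>)" for \<omega>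
    by (simp add: exp_add[symmetric] algebra_simps)
  have int_p: "integrable M (\<lambda>\<omega>. ?e \<omega> * exp (- s * ?D \<omega>))"
    unfolding eq[symmetric] by (intro integrable_mult_right mart)
  have E_p: "expectation (\<lambda>\<omega>. ?e \<omega> * exp (- s * ?D \<omega>)) = exp (s * ln (real n))"
    unfolding eq[symmetric] integral_mult_right_zero mart by simp
  have s_le: "cmod s \<le> \<bar>t\<bar>"
    unfolding s_def by (rule norm_iexp_minus_one_le)
  have bound: "cmod (?e \<omega> - ?e \<omega> * exp (- s * ?D \<omega>)) \<le> 4 * \<bar>t\<bar> * exp (\<bar>?D \<omega>\<bar> / 2)" for \<omega>
  proof -
    let ?x = "\<bar>?D \<omega>\<bar>"
    have "cmod (- s * ?D \<omega>) \<le> \<bar>t\<bar> * ?x"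
      using mult_right_mono[OF s_le, of ?x] by (simp add: norm_mult del: of_real_diff)
    moreover have "\<bar>t\<bar> * ?x \<le> 1 / 4 * ?x"
      using t by (intro mult_right_mono) auto
    ultimately have z: "cmod (- s * ?D \<omega>) \<le> \<bar>t\<bar> * ?x" "cmod (- s * ?D \<omega>) \<le> ?x / 4"
      by auto
    have "cmod (?e \<omega> - ?e \<omega> * exp (- s * ?D \<omega>)) = cmod (?e \<omega> * (1 - exp (- s * ?D \<omega>)))"
      by (simp only: right_diff_distrib mult_1_right)
    also have "\<dots> = cmod (exp (- s * ?D \<omega>) - 1)"
      unfolding norm_mult norm_e by (simp only: mult_1_left norm_minus_commute)
    also have "\<dots> \<le> exp (cmod (- s * ?D \<omega>)) * cmod (- s * ?D \<omega>)"
      by (rule norm_exp_minus_one_le)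
    also have "\<dots> \<le> exp (?x / 4) * (\<bar>t\<bar> * ?x)"
      using z by (intro mult_mono) auto
    \<comment> \<open>The linear factor is absorbed by a second exp (x / 4), so that the product is
      the exp (x / 2) controlled by \<open>exp_deviation\<close>; this is why t is restricted to
      1/4.\<close>
    also have "\<dots> \<le> exp (?x / 4) * (\<bar>t\<bar> * (4 * exp (?x / 4)))"
    proof (intro mult_left_mono)
      show "?x \<le> 4 * exp (?x / 4)"
        using le_exp_half[of "?x / 2"] by simp
    qed auto
    also have "\<dots> = 4 * \<bar>t\<bar> * exp (?x / 4 + ?x / 4)"
      unfolding exp_add by simp
    finally show ?thesis
      by simp
  qed
  have "cmod (expectation ?e - exp (s * ln (real n))) = cmod (expectation (\<lambda>\<omega>. ?e \<omega> - ?e \<omega> * exp (- s * ?D \<omega>)))"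
    unfolding E_p[symmetric] Bochner_Integration.integral_diff[OF int_e int_p] ..
  also have "\<dots> \<le> expectation (\<lambda>\<omega>. cmod (?e \<omega> - ?e \<omega> * exp (- s * ?D \<omega>)))"
    by (rule integral_norm_bound)
  also have "\<dots> \<le> expectation (\<lambda>\<omega>. 4 * \<bar>t\<bar> * exp (\<bar>?D \<omega>\<bar> / 2))"
    using exp_deviation(1)[OF n] int_e int_p
    by (intro integral_mono bound integrable_norm Bochner_Integration.integrable_diff integrable_mult_right)
  also have "\<dots> = 4 * \<bar>t\<bar> * expectation (\<lambda>\<omega>. exp (\<bar>?D \<omega>\<bar> / 2))"
    by simp
  also have "\<dots> \<le> 4 * \<bar>t\<bar> * dev_bound"
    by (intro mult_left_mono exp_deviation(2)[OF n]) auto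
  finally show ?thesis
    by (simp add: s_def mult_ac)
qed

text \<open>By Levy's theorem pointwise convergence of characteristic functions suffices. At the
  scale u = t / sqrt (ln n) the error of \<open>char_rec_num_close\<close> vanishes, and only the
  explicit function \<open>\<phi>\<close> has to be studied.\<close>

lemma asymptotic_normality:
  "weak_conv_m (\<lambda>n. distr M borel (\<lambda>\<omega>. (real (rec_num n \<omega>) - 1 / real CARD('d) * ln (real n))
      / (1 / real CARD('d) * sqrt (ln (real n))))) std_normal_distribution"
proof (rule levy_continuity)
  let ?Z = "\<lambda>n \<omega>. (real (rec_num n \<omega>) - 1 / real CARD('d) * ln (real n)) / (1 / real CARD('d) * sqrt (ln (real n)))"
  have [measurable]: "?Z n \<in> borel_measurable M" for n
    by measurable
  show "real_distribution (distr M borel (?Z n))" for n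
    by (rule real_distribution_distr) measurable
  show "real_distribution std_normal_distribution"
    by (rule real_dist_normal_dist)
  fix t :: real
  define u where "u n = t / sqrt (ln (real n))" for n
  \<comment> \<open>The characteristic function at t of a Poisson variable of mean ln n, centred and
    divided by sqrt (ln n).\<close>
  define \<phi> where "\<phi> n = exp ((iexp (u n) - 1 - \<i> * u n) * ln (real n))" for n
  have u_lim: "u \<longlonglongrightarrow> 0"
    unfolding u_def by real_asymp
  then have u_small: "eventually (\<lambda>n. \<bar>u n\<bar> \<le> 1 / 4) at_top"
    using tendstoD[of u 0 at_top "1/4"] by (auto elim: eventually_mono)
  have "(\<lambda>n. char (distr M borel (?Z n)) t - \<phi> n) \<longlonglongrightarrow> 0"
  proof (rule Lim_null_comparison)
    show "(\<lambda>n. 4 * dev_bound * \<bar>u n\<bar>) \<longlonglongrightarrow> 0"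
      by (intro tendsto_mult_right_zero tendsto_rabs_zero u_lim)
    show "eventually (\<lambda>n. cmod (char (distr M borel (?Z n)) t - \<phi> n) \<le> 4 * dev_bound * \<bar>u n\<bar>) at_top"
      using u_small eventually_ge_at_top[of 2]
    proof eventually_elim
      case (elim n)
      have lnn: "0 < ln (real n)"
        using elim by simp
      have tZ: "t * ?Z n \<omega> = u n * CARD('d) * real (rec_num n \<omega>) - u n * ln (real n)" for \<omega>
        using lnn by (simp add: u_def field_simps)
      have "char (distr M borel (?Z n)) t = expectation (\<lambda>\<omega>. iexp (t * ?Z n \<omega>))"
        unfolding char_def by (subst integral_distr) auto
      also have "\<dots> = expectation (\<lambda>\<omega>. exp (- \<i> * u n * ln (real n)) * exp (\<i> * u n * CARD('d) * of_nat (rec_num n \<omega>)))"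
        unfolding tZ by (intro Bochner_Integration.integral_cong) (auto simp: exp_add[symmetric] algebra_simps)
      finally have char: "char (distr M borel (?Z n)) t
          = exp (- \<i> * u n * ln (real n)) * expectation (\<lambda>\<omega>. exp (\<i> * u n * CARD('d) * of_nat (rec_num n \<omega>)))"
        unfolding integral_mult_right_zero .
      have phi: "\<phi> n = exp (- \<i> * u n * ln (real n)) * exp ((iexp (u n) - 1) * ln (real n))"
        unfolding \<phi>_def by (simp add: exp_add[symmetric] algebra_simps)
      \<comment> \<open>The common factor exp (-i u ln n) has modulus 1 and drops out.\<close>
      have "cmod (char (distr M borel (?Z n)) t - \<phi> n)
          = cmod (expectation (\<lambda>\<omega>. exp (\<i> * u n * CARD('d) * of_nat (rec_num n \<omega>))) - exp ((iexp (u n) - 1) * ln (real n)))"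
        unfolding char phi right_diff_distrib[symmetric] norm_mult by simp
      also have "\<dots> \<le> 4 * dev_bound * \<bar>u n\<bar>"
        by (rule char_rec_num_close) (use elim in auto)
      finally show ?case .
    qed
  qed
  moreover have "\<phi> \<longlonglongrightarrow> exp (of_real (- (t\<^sup>2) / 2))"
    unfolding \<phi>_def[abs_def]
  proof (intro tendsto_exp)
    have "(\<lambda>n. (iexp (u n) - 1 - \<i> * u n) * ln (real n) - of_real (- (t\<^sup>2) / 2)) \<longlonglongrightarrow> 0"
    proof (rule Lim_null_comparison)
      show "(\<lambda>n. \<bar>t\<bar> ^ 3 / 6 / sqrt (ln (real n))) \<longlonglongrightarrow> 0"
        by real_asymp
      show "eventually (\<lambda>n. cmod ((iexp (u n) - 1 - \<i> * u n) * ln (real n) - of_real (- (t\<^sup>2) / 2))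
          \<le> \<bar>t\<bar> ^ 3 / 6 / sqrt (ln (real n))) at_top"
        using eventually_ge_at_top[of 2]
      proof eventually_elim
        case (elim n)
        have lnn: "0 < ln (real n)"
          using elim by simp
        then have sq: "sqrt (ln (real n)) * sqrt (ln (real n)) = ln (real n)" and "0 < sqrt (ln (real n))"
          by simp_all
        have u2: "(u n)\<^sup>2 * ln (real n) = t\<^sup>2"
          using lnn by (simp add: u_def power_divide)
        have u3: "\<bar>u n\<bar> ^ 3 * ln (real n) = \<bar>t\<bar> ^ 3 / sqrt (ln (real n))"
          using lnn sq by (simp add: u_def power_divide abs_divide power3_eq_cube field_simps)
        \<comment> \<open>Since u^2 ln n = t^2, the limit -t^2 / 2 is the quadratic Taylor term
          times ln n; what remains is the cubic remainder, of order 1 / sqrt (ln n).\<close>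
        have "(iexp (u n) - 1 - \<i> * u n) * ln (real n) - of_real (- (t\<^sup>2) / 2)
            = (iexp (u n) - (\<Sum>k\<le>2. (\<i> * u n)^k / fact k)) * ln (real n)"
          unfolding u2[symmetric]
          by (simp add: numeral_2_eq_2 power2_eq_square algebra_simps)
        then have "cmod ((iexp (u n) - 1 - \<i> * u n) * ln (real n) - of_real (- (t\<^sup>2) / 2))
            = cmod (iexp (u n) - (\<Sum>k\<le>2. (\<i> * u n)^k / fact k)) * ln (real n)"
          using lnn by (simp only: norm_mult norm_of_real abs_of_pos)
        also have "\<dots> \<le> \<bar>u n\<bar> ^ Suc 2 / fact (Suc 2) * ln (real n)"
          using lnn by (intro mult_right_mono iexp_approx1) auto
        also have "\<dots> = \<bar>u n\<bar> ^ 3 * ln (real n) / 6"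
          by (simp add: fact_numeral eval_nat_numeral)
        also have "\<dots> = \<bar>t\<bar> ^ 3 / 6 / sqrt (ln (real n))"
          unfolding u3 by simp
        finally show ?case .
      qed
    qed
    then show "(\<lambda>n. (iexp (u n) - 1 - \<i> * u n) * ln (real n)) \<longlonglongrightarrow> of_real (- (t\<^sup>2) / 2)"
      by (rule LIM_zero_cancel)
  qed
  ultimately have "(\<lambda>n. char (distr M borel (?Z n)) t - \<phi> n + \<phi> n) \<longlonglongrightarrow> 0 + exp (of_real (- (t\<^sup>2) / 2))"
    by (rule tendsto_add)
  then show "(\<lambda>n. char (distr M borel (?Z n)) t) \<longlonglongrightarrow> char std_normal_distribution t"
    by (simp add: char_std_normal_distribution exp_of_real[symmetric])
qed

end

theorem proposition1:
  fixes M :: "'a measure" and X :: "nat \<Rightarrow> 'a \<Rightarrow> real ^ 'd"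
  assumes "prob_space M"
    and "prob_space.indep_vars M (\<lambda>_. borel) X {1..}"
    and "\<And>i. i \<ge> 1 \<Longrightarrow> distr M borel (X i) = uniform_measure lborel (cbox 0 1)"
  defines "N \<equiv> \<lambda>n \<omega>. real (num_records (\<lambda>i. X i \<omega>) n)"
  shows "(\<lambda>n. prob_space.expectation M (N n)) \<sim>[at_top] (\<lambda>n. 1 / real CARD('d) * ln (real n))
    \<and> (\<lambda>n. prob_space.variance M (N n)) \<sim>[at_top] (\<lambda>n. 1 / (real CARD('d))\<^sup>2 * ln (real n))
    \<and> weak_conv_m
        (\<lambda>n. distr M borel (\<lambda>\<omega>. (N n \<omega> - 1 / real CARD('d) * ln (real n))
                                  / (1 / real CARD('d) * sqrt (ln (real n)))))
        std_normal_distribution"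
proof -
  interpret prob_space M
    by fact
  interpret uniform_marks M X
    by unfold_locales fact+
  have "N n = (\<lambda>\<omega>. real (rec_num n \<omega>))" for n
    by (simp add: N_def rec_num_def num_records_eq_record_count)
  then show ?thesis
    using expectation_asymp variance_asymp asymptotic_normality by simp
qed

end
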